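(* Let $\tau > \omega$ be a cardinal. Then the correspondence $\mu \colon {\mathcal H}_{p}({\mathcal Z}_{\tau}) \to {\mathcal H}({\mathcal Z}_{\tau})$, defined by letting: (i) for an object $I^{\tau}\setminus X$ of ${\mathcal H}_{p}({\mathcal Z}_{\tau})$, $\mu (I^{\tau}\setminus X) = X$; (ii) for a morphism $[g] \colon I^{\tau}\setminus X \to I^{\tau}\setminus Y$ of ${\mathcal H}_{p}({\mathcal Z}_{\tau})$, $\mu([g]) = [\widetilde{g}|X]$, is an isomorphism of categories.
   Context: $I=[0,1]$; a map (continuous) is proper if preimages of compact sets are compact. ${\mathcal H}({\mathcal Z}_\tau)$ is the category whose objects are the $Z_\tau$-sets of the cube $I^\tau$ and whose morphisms are homotopy classes of continuous maps. ${\mathcal H}_p({\mathcal Z}_\tau)$ is the category whose objects are the complements $I^\tau\setminus X$ of $Z_\tau$-sets $X$ in $I^\tau$ and whose morphisms are proper homotopy classes of proper maps (a proper homotopy is a homotopy $(I^\tau\setminus X)\times[0,1]\to I^\tau\setminus Y$ that is a proper map). $[\cdot]$ denotes the respective class. For $\tau>\omega$ and a $Z_\tau$-set $X\subset I^\tau$, $I^\tau$ is the Stone-Čech compactification of $I^\tau\setminus X$, so a proper map $g\colon I^\tau\setminus X\to I^\tau\setminus Y$ has a unique extension $\widetilde g\colon I^\tau\to I^\tau$, and $\widetilde g(X)\subset Y$. $Z_\tau$-sets: for a Tychonov space $Y$ let $\operatorname{cov}(Y)$ be the collection of all countable covers of $Y$ by functionally open (cozero) sets. Maps $f,g\colon X\to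 Y$ are ${\mathcal U}$-close if for each $x\in X$ some $U\in{\mathcal U}$ contains both $f(x)$ and $g(x)$. $C_\tau(X,Y)$ is the set of continuous maps $X\to Y$ with the topology in which $G$ is open iff for each $h\in G$ there is a family $\{{\mathcal U}_t\colon t\in T\}\subseteq\operatorname{cov}(Y)$ with $|T|<\tau$ such that every $g$ that is ${\mathcal U}_t$-close to $h$ for all $t\in T$ belongs to $G$. A closed subset $A\subset X$ is a $Z_\tau$-set in $X$ if $\{f\in C_\tau(X,X)\colon f(X)\cap A=\emptyset\}$ is dense in $C_\tau(X,X)$. *)

theory Defs
  imports "HOL-Analysis.Analysis"
begin

unbundle cardinal_syntax

section \<open>Categories, functors, isomorphisms of categories\<close>

text \<open>Hom-sets are indexed by source and target and need not be disjoint, so composition, and the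
  action of a functor on morphisms, take the objects involved as arguments:
  \<open>Comp C X Y Z g f\<close> is the composite of \<open>f : X \<rightarrow> Y\<close> with \<open>g : Y \<rightarrow> Z\<close>.\<close>

record ('o, 'm) cat =
  Obj :: "'o set"
  Hom :: "'o \<Rightarrow> 'o \<Rightarrow> 'm set"
  Ident :: "'o \<Rightarrow> 'm"
  Comp :: "'o \<Rightarrow> 'o \<Rightarrow> 'o \<Rightarrow> 'm \<Rightarrow> 'm \<Rightarrow> 'm"

definition is_category :: "('o, 'm) cat \<Rightarrow> bool" where
  "is_category C \<longleftrightarrow>
     (\<forall>X\<in>Obj C. Ident C X \<in> Hom C X X) \<and>
     (\<forall>X\<in>Obj C. \<forall>Y\<in>Obj C. \<forall>Z\<in>Obj C. \<forall>f\<in>Hom C X Y. \<forall>g\<in>Hom C Y Z.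
        Comp C X Y Z g f \<in> Hom C X Z) \<and>
     (\<forall>X\<in>Obj C. \<forall>Y\<in>Obj C. \<forall>f\<in>Hom C X Y.
        Comp C X X Y f (Ident C X) = f \<and> Comp C X Y Y (Ident C Y) f = f) \<and>
     (\<forall>W\<in>Obj C. \<forall>X\<in>Obj C. \<forall>Y\<in>Obj C. \<forall>Z\<in>Obj C.
        \<forall>f\<in>Hom C W X. \<forall>g\<in>Hom C X Y. \<forall>h\<in>Hom C Y Z.
          Comp C W X Z (Comp C X Y Z h g) f = Comp C W Y Z h (Comp C W X Y g f))"

definition is_functor ::
    "('o, 'm) cat \<Rightarrow> ('p, 'n) cat \<Rightarrow> ('o \<Rightarrow> 'p) \<Rightarrow> ('o \<Rightarrow> 'o \<Rightarrow> 'm \<Rightarrow> 'n) \<Rightarrow> bool" where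
  "is_functor C D F0 F1 \<longleftrightarrow>
     is_category C \<and> is_category D \<and>
     (\<forall>X\<in>Obj C. F0 X \<in> Obj D) \<and>
     (\<forall>X\<in>Obj C. \<forall>Y\<in>Obj C. \<forall>f\<in>Hom C X Y. F1 X Y f \<in> Hom D (F0 X) (F0 Y)) \<and>
     (\<forall>X\<in>Obj C. F1 X X (Ident C X) = Ident D (F0 X)) \<and>
     (\<forall>X\<in>Obj C. \<forall>Y\<in>Obj C. \<forall>Z\<in>Obj C. \<forall>f\<in>Hom C X Y. \<forall>g\<in>Hom C Y Z.
        F1 X Z (Comp C X Y Z g f) = Comp D (F0 X) (F0 Y) (F0 Z) (F1 Y Z g) (F1 X Y f))"

definition is_category_isomorphism ::
    "('o, 'm) cat \<Rightarrow> ('p, 'n) cat \<Rightarrow> ('o \<Rightarrow> 'p) \<Rightarrow> ('o \<Rightarrow> 'o \<Rightarrow> 'm \<Rightarrow> 'n) \<Rightarrow> bool" where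
  "is_category_isomorphism C D F0 F1 \<longleftrightarrow>
     is_functor C D F0 F1 \<and>
     (\<exists>G0 G1. is_functor D C G0 G1 \<and>
        (\<forall>X\<in>Obj C. G0 (F0 X) = X) \<and>
        (\<forall>X\<in>Obj C. \<forall>Y\<in>Obj C. \<forall>f\<in>Hom C X Y. G1 (F0 X) (F0 Y) (F1 X Y f) = f) \<and>
        (\<forall>X\<in>Obj D. F0 (G0 X) = X) \<and>
        (\<forall>X\<in>Obj D. \<forall>Y\<in>Obj D. \<forall>f\<in>Hom D X Y. F1 (G0 X) (G0 Y) (G1 X Y f) = f))"


section \<open>$Z_\tau$-sets\<close>

definition cozero_in :: "'a topology \<Rightarrow> 'a set \<Rightarrow> bool" where
  "cozero_in Y U \<longleftrightarrow>
     (\<exists>f. continuous_map Y euclideanreal f \<and> U = {y \<in> topspace Y. f y \<noteq> 0})"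

definition cov :: "'a topology \<Rightarrow> 'a set set set" where
  "cov Y = {\<U>. countable \<U> \<and> (\<forall>U\<in>\<U>. cozero_in Y U) \<and> \<Union>\<U> = topspace Y}"

definition cover_close :: "'a topology \<Rightarrow> 'b set set \<Rightarrow> ('a \<Rightarrow> 'b) \<Rightarrow> ('a \<Rightarrow> 'b) \<Rightarrow> bool" where
  "cover_close X \<U> f g \<longleftrightarrow> (\<forall>x\<in>topspace X. \<exists>U\<in>\<U>. f x \<in> U \<and> g x \<in> U)"

text \<open>The points of the function space are the continuous maps, represented by functions that are
  \<open>undefined\<close> outside \<open>topspace X\<close>, so that distinct points are distinct maps.\<close>

definition continuous_maps :: "'a topology \<Rightarrow> 'b topology \<Rightarrow> ('a \<Rightarrow> 'b) set" where
  "continuous_maps X Y = {f \<in> extensional (topspace X). continuous_map X Y f}"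

definition open_in_C :: "'k rel \<Rightarrow> 'a topology \<Rightarrow> 'b topology \<Rightarrow> ('a \<Rightarrow> 'b) set \<Rightarrow> bool" where
  "open_in_C \<tau> X Y G \<longleftrightarrow>
     G \<subseteq> continuous_maps X Y \<and>
     (\<forall>h\<in>G. \<exists>T. T \<subseteq> cov Y \<and> |T| <o \<tau> \<and>
        {g \<in> continuous_maps X Y. \<forall>\<U>\<in>T. cover_close X \<U> g h} \<subseteq> G)"

definition C_space :: "'k rel \<Rightarrow> 'a topology \<Rightarrow> 'b topology \<Rightarrow> ('a \<Rightarrow> 'b) topology" where
  "C_space \<tau> X Y = topology (open_in_C \<tau> X Y)"

lemma openin_C_space:
  assumes "Card_order \<tau>" and "natLeq <o \<tau>"
  shows "openin (C_space \<tau> X Y) = open_in_C \<tau> X Y"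
proof -
  have inf: "infinite (Field \<tau>)"
    using cinfinite_mono[OF ordLess_imp_ordLeq[OF assms(2)] natLeq_cinfinite]
    by (simp add: cinfinite_def)
  define N where "N h T = {g \<in> continuous_maps X Y. \<forall>\<U>\<in>T. cover_close X \<U> g h}"
    for h and T :: "'c set set set"
  have op: "open_in_C \<tau> X Y G \<longleftrightarrow>
      G \<subseteq> continuous_maps X Y \<and> (\<forall>h\<in>G. \<exists>T. T \<subseteq> cov Y \<and> |T| <o \<tau> \<and> N h T \<subseteq> G)" for G
    unfolding open_in_C_def N_def by (rule refl)
  have "istopology (open_in_C \<tau> X Y)"
    unfolding istopology_def
  proof (intro conjI allI impI)
    fix S T assume S: "open_in_C \<tau> X Y S" and T: "open_in_C \<tau> X Y T"
    show "open_in_C \<tau> X Y (S \<inter> T)"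
      unfolding op
    proof (intro conjI ballI)
      show "S \<inter> T \<subseteq> continuous_maps X Y"
        using S unfolding op by (simp add: le_infI1)
    next
      fix h assume h: "h \<in> S \<inter> T"
      obtain A where A: "A \<subseteq> cov Y" "|A| <o \<tau>" "N h A \<subseteq> S"
        using conjunct2[OF S[unfolded op], rule_format, OF IntD1[OF h]] by (elim exE conjE)
      obtain B where B: "B \<subseteq> cov Y" "|B| <o \<tau>" "N h B \<subseteq> T"
        using conjunct2[OF T[unfolded op], rule_format, OF IntD2[OF h]] by (elim exE conjE)
      have "N h (A \<union> B) = N h A \<inter> N h B"
        unfolding N_def ball_Un by (rule set_eqI) (simp, argo)
      then have "N h (A \<union> B) \<subseteq> S \<inter> T"
        using Int_mono[OF A(3) B(3)] by (simp only:)
      then show "\<exists>C. C \<subseteq> cov Y \<and> |C| <o \<tau> \<and> N h C \<subseteq> S \<inter> T"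
        using Un_least[OF A(1) B(1)] card_of_Un_ordLess_infinite_Field[OF inf assms(1) A(2) B(2)]
        by (intro exI[of _ "A \<union> B"] conjI)
    qed
  next
    fix \<K> assume K: "\<forall>K\<in>\<K>. open_in_C \<tau> X Y K"
    show "open_in_C \<tau> X Y (\<Union>\<K>)"
      unfolding op
    proof (intro conjI ballI)
      show "\<Union>\<K> \<subseteq> continuous_maps X Y"
        using K unfolding op by (simp add: Sup_le_iff)
    next
      fix h assume "h \<in> \<Union>\<K>"
      then obtain K' where K': "K' \<in> \<K>" "h \<in> K'" by (rule UnionE)
      obtain T where T: "T \<subseteq> cov Y" "|T| <o \<tau>" "N h T \<subseteq> K'"
        using conjunct2[OF bspec[OF K K'(1), unfolded op], rule_format, OF K'(2)]
        by (elim exE conjE)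
      show "\<exists>T. T \<subseteq> cov Y \<and> |T| <o \<tau> \<and> N h T \<subseteq> \<Union>\<K>"
        by (intro exI[of _ T] conjI T(1,2) order_trans[OF T(3)] Union_upper K'(1))
    qed
  qed
  then show ?thesis
    unfolding C_space_def by (rule topology_inverse')
qed

definition Z_set :: "'k rel \<Rightarrow> 'a topology \<Rightarrow> 'a set \<Rightarrow> bool" where
  "Z_set \<tau> X A \<longleftrightarrow>
     closedin X A \<and>
     C_space \<tau> X X closure_of {f \<in> continuous_maps X X. f ` topspace X \<inter> A = {}}
       = topspace (C_space \<tau> X X)"


section \<open>The two homotopy categories\<close>

text \<open>The cardinal \<open>\<tau>\<close> is a cardinal order in the sense of \<open>Card_order\<close>; its field has cardinality
  \<open>\<tau>\<close> and serves as the index set of the cube.\<close>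

definition cube :: "'k rel \<Rightarrow> ('k \<Rightarrow> real) topology" where
  "cube \<tau> = product_topology (\<lambda>_. top_of_set {0..1}) (Field \<tau>)"

definition cube_compl :: "'k rel \<Rightarrow> ('k \<Rightarrow> real) set \<Rightarrow> ('k \<Rightarrow> real) set" where
  "cube_compl \<tau> X = topspace (cube \<tau>) - X"

definition proper_continuous_map :: "'a topology \<Rightarrow> 'b topology \<Rightarrow> ('a \<Rightarrow> 'b) \<Rightarrow> bool" where
  "proper_continuous_map X Y f \<longleftrightarrow>
     continuous_map X Y f \<and> (\<forall>K. compactin Y K \<longrightarrow> compactin X {x \<in> topspace X. f x \<in> K})"

text \<open>The interval factor comes first, as in \<^const>\<open>homotopic_with\<close>.\<close>

definition proper_homotopic :: "'a topology \<Rightarrow> 'b topology \<Rightarrow> ('a \<Rightarrow> 'b) \<Rightarrow> ('a \<Rightarrow> 'b) \<Rightarrow> bool" where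
  "proper_homotopic X Y f g \<longleftrightarrow>
     (\<exists>h. proper_continuous_map (prod_topology (top_of_set {0..1::real}) X) Y h \<and>
          (\<forall>x\<in>topspace X. h (0, x) = f x) \<and> (\<forall>x\<in>topspace X. h (1, x) = g x))"

text \<open>Both relations ignore the values of the functions outside \<open>topspace X\<close>, so maps that agree on
  \<open>topspace X\<close> have the same class.\<close>

definition homotopy_class :: "'a topology \<Rightarrow> 'b topology \<Rightarrow> ('a \<Rightarrow> 'b) \<Rightarrow> ('a \<Rightarrow> 'b) set" where
  "homotopy_class X Y f = {g. homotopic_with (\<lambda>_. True) X Y f g}"

definition proper_homotopy_class :: "'a topology \<Rightarrow> 'b topology \<Rightarrow> ('a \<Rightarrow> 'b) \<Rightarrow> ('a \<Rightarrow> 'b) set" where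
  "proper_homotopy_class X Y f = {g. proper_homotopic X Y f g}"

text \<open>In both categories the composite of two classes is the union of the classes of all composites
  of representatives, which is the class of any one of them.\<close>

definition H_cat :: "'k rel \<Rightarrow> (('k \<Rightarrow> real) set, (('k \<Rightarrow> real) \<Rightarrow> 'k \<Rightarrow> real) set) cat" where
  "H_cat \<tau> =
    (let S = subtopology (cube \<tau>) in
     \<lparr> Obj = {X. Z_set \<tau> (cube \<tau>) X},
       Hom = (\<lambda>X Y. {homotopy_class (S X) (S Y) f | f. continuous_map (S X) (S Y) f}),
       Ident = (\<lambda>X. homotopy_class (S X) (S X) id),
       Comp = (\<lambda>X Y Z d c. \<Union>f\<in>c. \<Union>g\<in>d. homotopy_class (S X) (S Z) (g \<circ> f)) \<rparr>)"

definition Hp_cat :: "'k rel \<Rightarrow> (('k \<Rightarrow> real) set, (('k \<Rightarrow> real) \<Rightarrow> 'k \<Rightarrow> real) set) cat" where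
  "Hp_cat \<tau> =
    (let S = subtopology (cube \<tau>) in
     \<lparr> Obj = {cube_compl \<tau> X | X. Z_set \<tau> (cube \<tau>) X},
       Hom = (\<lambda>M N. {proper_homotopy_class (S M) (S N) f | f. proper_continuous_map (S M) (S N) f}),
       Ident = (\<lambda>M. proper_homotopy_class (S M) (S M) id),
       Comp = (\<lambda>M N P d c. \<Union>f\<in>c. \<Union>g\<in>d. proper_homotopy_class (S M) (S P) (g \<circ> f)) \<rparr>)"


section \<open>The correspondence $\mu$\<close>

text \<open>The extension of a map defined on \<open>M\<close> to a continuous self-map of the cube; it exists and is
  unique for \<open>\<tau> > \<omega>\<close>, \<open>M\<close> the complement of a $Z_\tau$-set and proper \<open>g\<close> between such complements.\<close>

definition cube_extension ::
    "'k rel \<Rightarrow> ('k \<Rightarrow> real) set \<Rightarrow> (('k \<Rightarrow> real) \<Rightarrow> 'k \<Rightarrow> real) \<Rightarrow> ('k \<Rightarrow> real) \<Rightarrow> 'k \<Rightarrow> real" where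
  "cube_extension \<tau> M g =
     (THE h. h \<in> continuous_maps (cube \<tau>) (cube \<tau>) \<and> (\<forall>x\<in>M. h x = g x))"

text \<open>Since \<open>X \<subseteq> I\<^sup>\<tau>\<close>, the object \<open>X\<close> is recovered from \<open>I\<^sup>\<tau> \ X\<close> as its complement.\<close>

definition mu_obj :: "'k rel \<Rightarrow> ('k \<Rightarrow> real) set \<Rightarrow> ('k \<Rightarrow> real) set" where
  "mu_obj \<tau> M = cube_compl \<tau> M"

definition mu_mor ::
    "'k rel \<Rightarrow> ('k \<Rightarrow> real) set \<Rightarrow> ('k \<Rightarrow> real) set \<Rightarrow>
     (('k \<Rightarrow> real) \<Rightarrow> 'k \<Rightarrow> real) set \<Rightarrow> (('k \<Rightarrow> real) \<Rightarrow> 'k \<Rightarrow> real) set" where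
  "mu_mor \<tau> M N c =
     (\<Union>g\<in>c. homotopy_class (subtopology (cube \<tau>) (mu_obj \<tau> M)) (subtopology (cube \<tau>) (mu_obj \<tau> N))
               (restrict (cube_extension \<tau> M g) (mu_obj \<tau> M)))"

end

theory Submission
  imports Defs
begin

text \<open>
  Write \<open>M = I\<^sup>\<tau> \ X\<close> and \<open>N = I\<^sup>\<tau> \ Y\<close> for $Z_\tau$-sets \<open>X\<close> and \<open>Y\<close>. The proof replaces a proper map
  \<open>g : M \<rightarrow> N\<close> by its extension to the cube, which is a self-map \<open>F\<close> with \<open>F\<^sup>-\<^sup>1(Y) = X\<close>, and it treats
  proper homotopies in the same way over the cylinder \<open>[0,1] \<times> I\<^sup>\<tau>\<close>. On objects \<open>\<mu>\<close> is complementation,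
  so everything rests on two extension theorems, one in each direction.

  Both use the same consequence of the definition of a $Z_\tau$-set. For a set \<open>J\<close> of fewer than \<open>\<tau>\<close>
  coordinates, the self-maps of the cube that do not change the coordinates in \<open>J\<close> form an open
  neighbourhood of the identity, so density yields such a map with image disjoint from \<open>X\<close>
  (\<open>Z_set_avoiding_map\<close>).

  From the complement to the cube: a continuous function on \<open>[0,1] \<times> M\<close> extends continuously to the
  cylinder. Otherwise it oscillates at some point \<open>a\<close>, and this is witnessed by a sequence of pairs of
  points of \<open>M\<close>. Continuity at these points involves countably many coordinates in all. As \<open>\<tau>\<close> is
  uncountable, \<open>M\<close> contains a point \<open>b\<close> that has these coordinates in common with \<open>a\<close>, and
  changing the remaining coordinates moves both halves of the sequence to \<open>b\<close>, where the function is
  continuous (\<open>small_oscillation\<close>, \<open>extend_from_thick_cylinder\<close>). Compactness then shows that the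
  extension of a proper map or homotopy sends no point over \<open>X\<close> into \<open>N\<close>; conversely a map of the cube
  with \<open>F\<^sup>-\<^sup>1(Y) = X\<close> restricts to a proper map of the complements.

  From the boundary to the cube: a map into the cube given on a closed set \<open>A\<close> extends, without
  meeting \<open>Y\<close> off \<open>A\<close>, as soon as the complement of \<open>A\<close> is a union of at most \<open>\<tau>\<close> closed sets. Tietze's
  theorem gives some extension; it is corrected by transfinite recursion over \<open>\<tau>\<close>, where each step
  alters finitely many new coordinates and thereby takes care of one of the closed sets
  (\<open>extend_avoiding_Z_set\<close>). For \<open>A = X\<close> this shows that \<open>\<mu>\<close> is surjective on morphisms, and for
  \<open>A = [0,1] \<times> X \<union> {0,1} \<times> I\<^sup>\<tau>\<close> in the cylinder that it is injective.

  As extensions are unique, they are compatible with composition. So \<open>\<mu>\<close> is bijective on hom-sets and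
  preserves identities and composites, and the category laws of \<open>H\<^sub>p\<close> follow from those of \<open>H\<close>
  (\<open>is_category_isomorphismI\<close>).
\<close>

section \<open>The Tychonoff cube\<close>

lemma topspace_cube: "topspace (cube \<tau>) = (\<Pi>\<^sub>E k\<in>Field \<tau>. {0..1})"
  by (simp add: cube_def)

lemma compact_space_cube: "compact_space (cube \<tau>)"
  by (simp add: cube_def compact_space_product_topology compact_space_subtopology)

lemma Hausdorff_space_cube: "Hausdorff_space (cube \<tau>)"
  by (simp add: cube_def Hausdorff_space_product_topology Hausdorff_space_subtopology)

lemma continuous_map_cube_iff:
  "continuous_map T (cube \<tau>) f \<longleftrightarrow>
     f \<in> topspace T \<rightarrow> topspace (cube \<tau>) \<and>
     (\<forall>k\<in>Field \<tau>. continuous_map T euclideanreal (\<lambda>x. f x k))"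
  unfolding cube_def continuous_map_componentwise continuous_map_in_subtopology
  by (auto simp: PiE_iff Pi_iff image_subset_iff)

lemma continuous_map_cube_component:
  "k \<in> Field \<tau> \<Longrightarrow> continuous_map (cube \<tau>) euclideanreal (\<lambda>x. x k)"
  using continuous_map_cube_iff[of "cube \<tau>" \<tau> id] by simp

lemma cube_component_bounds:
  "x \<in> topspace (cube \<tau>) \<Longrightarrow> k \<in> Field \<tau> \<Longrightarrow> 0 \<le> x k \<and> x k \<le> 1"
  by (auto simp: topspace_cube PiE_iff)

lemma cube_eqI:
  "x \<in> topspace (cube \<tau>) \<Longrightarrow> y \<in> topspace (cube \<tau>) \<Longrightarrow> (\<And>k. k \<in> Field \<tau> \<Longrightarrow> x k = y k) \<Longrightarrow> x = y"
  unfolding topspace_cube by (rule PiE_ext)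

lemma override_on_mem_cube:
  "x \<in> topspace (cube \<tau>) \<Longrightarrow> y \<in> topspace (cube \<tau>) \<Longrightarrow> override_on x y R \<in> topspace (cube \<tau>)"
  by (auto simp: topspace_cube PiE_iff override_on_def extensional_def)

lemma openin_cube_contains_box:
  assumes "openin (cube \<tau>) W" "a \<in> W"
  obtains S e where "finite S" "S \<subseteq> Field \<tau>" "e > 0"
    "\<And>x. x \<in> topspace (cube \<tau>) \<Longrightarrow> (\<And>k. k \<in> S \<Longrightarrow> \<bar>x k - a k\<bar> < e) \<Longrightarrow> x \<in> W"
proof -
  obtain U where U: "finite {k\<in>Field \<tau>. U k \<noteq> {0..1::real}}"
    "\<And>k. k \<in> Field \<tau> \<Longrightarrow> openin (top_of_set {0..1::real}) (U k)"
    "a \<in> Pi\<^sub>E (Field \<tau>) U" "Pi\<^sub>E (Field \<tau>) U \<subseteq> W"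
    using assms unfolding cube_def openin_product_topology_alt by force
  define S where "S = {k\<in>Field \<tau>. U k \<noteq> {0..1::real}}"
  have "\<exists>e>0. \<forall>r\<in>{0..1}. \<bar>r - a k\<bar> < e \<longrightarrow> r \<in> U k" if k: "k \<in> S" for k
  proof -
    have "openin (top_of_set {0..1}) (U k)" "a k \<in> U k"
      using U k by (auto simp: S_def PiE_iff)
    then show ?thesis
      unfolding openin_euclidean_subtopology_iff by (simp add: dist_real_def)
  qed
  then obtain e where e: "\<And>k. k \<in> S \<Longrightarrow> e k > 0"
    "\<And>k r. k \<in> S \<Longrightarrow> r \<in> {0..1} \<Longrightarrow> \<bar>r - a k\<bar> < e k \<Longrightarrow> r \<in> U k"
    by metis
  have finS: "finite S" using U(1) by (simp add: S_def)
  define d where "d = Min (insert 1 (e ` S))"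
  have d: "d > 0" "\<And>k. k \<in> S \<Longrightarrow> d \<le> e k"
    using finS e(1) by (auto simp: d_def)
  show ?thesis
  proof (rule that[of S d])
    fix x assume x: "x \<in> topspace (cube \<tau>)" and close: "\<And>k. k \<in> S \<Longrightarrow> \<bar>x k - a k\<bar> < d"
    have "x k \<in> U k" if k: "k \<in> Field \<tau>" for k
    proof (cases "k \<in> S")
      case True
      then show ?thesis
        using e(2)[OF True] close[OF True] d(2)[OF True] x k by (force simp: topspace_cube PiE_iff)
    next
      case False
      then show ?thesis using x k by (auto simp: S_def topspace_cube PiE_iff)
    qed
    then have "x \<in> Pi\<^sub>E (Field \<tau>) U"
      using x by (simp add: topspace_cube PiE_iff)
    then show "x \<in> W"
      using U(4) by blast
  qed (use finS d in \<open>auto simp: S_def\<close>)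
qed

section \<open>Cardinal arithmetic\<close>

lemma infinite_Field: "natLeq <o \<tau> \<Longrightarrow> infinite (Field \<tau>)"
  using cinfinite_mono[OF ordLess_imp_ordLeq natLeq_cinfinite] by (simp add: cinfinite_def)

lemma countable_ordLess:
  assumes "natLeq <o \<tau>" "countable J"
  shows "|J| <o \<tau>"
proof -
  obtain f where "inj_on f J" "f ` J \<subseteq> (UNIV::nat set)"
    using assms(2) unfolding countable_def by auto
  then have "|J| \<le>o |UNIV::nat set|"
    using card_of_ordLeq by blast
  then have "|J| \<le>o natLeq"
    using card_of_nat ordLeq_ordIso_trans by blast
  then show ?thesis using assms(1) by (rule ordLeq_ordLess_trans)
qed

lemma ordLess_Times_nat:
  assumes "natLeq <o \<tau>" "|J| <o \<tau>"
  shows "|J \<times> (UNIV::nat set)| <o \<tau>"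
proof (cases "finite J")
  case True
  then have "countable (J \<times> (UNIV::nat set))" by (simp add: countable_finite)
  then show ?thesis by (rule countable_ordLess[OF assms(1)])
next
  case False
  then have "|J \<times> (UNIV::nat set)| =o |J|"
    by (intro card_of_Times_infinite_simps(1)) (auto simp: infinite_iff_card_of_nat)
  then show ?thesis using assms(2) ordIso_ordLess_trans by blast
qed

text \<open>Since \<open>\<tau>\<close> need not be regular, unions of fewer than \<open>\<tau>\<close> small sets can be large; for finite sets the
  cardinality of the union is at most that of the product of the index set with the natural numbers.\<close>

lemma ordLess_UNION_finite:
  assumes "natLeq <o \<tau>" "|B| <o \<tau>" "\<And>b. b \<in> B \<Longrightarrow> finite (K b)"
  shows "|\<Union>b\<in>B. K b| <o \<tau>"
proof -
  have "|K b| \<le>o |UNIV::nat set|" if "b \<in> B" for b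
    using assms(3)[OF that] finite_iff_ordLess_natLeq card_of_nat
      ordLess_imp_ordLeq ordIso_symmetric ordLeq_ordIso_trans by metis
  then have "|SIGMA b:B. K b| \<le>o |B \<times> (UNIV::nat set)|"
    by (intro card_of_Sigma_mono1) auto
  then have "|\<Union>b\<in>B. K b| \<le>o |B \<times> (UNIV::nat set)|"
    using card_of_UNION_Sigma ordLeq_transitive by blast
  then show ?thesis
    using ordLess_Times_nat[OF assms(1,2)] by (rule ordLeq_ordLess_trans)
qed

lemma card_Fpow_ordLeq:
  assumes tau: "Card_order \<tau>" "natLeq <o \<tau>"
  shows "|Fpow (Field \<tau>)| \<le>o \<tau>"
proof -
  note inf = infinite_Field[OF tau(2)]
  have F: "|Field \<tau>| \<le>o \<tau>"
    using card_of_Field_ordIso[OF tau(1)] by (rule ordIso_imp_ordLeq)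
  have nat: "|UNIV::nat set| \<le>o \<tau>"
    using ordIso_ordLeq_trans[OF card_of_nat ordLess_imp_ordLeq[OF tau(2)]] .
  define Fn where "Fn n = {S. S \<subseteq> Field \<tau> \<and> finite S \<and> card S = n}" for n
  have "|Fn n| \<le>o \<tau>" for n
  proof (induction n)
    case 0
    have "Fn 0 = {{}}" by (auto simp: Fn_def)
    moreover have "Field \<tau> \<noteq> {}" using inf by auto
    ultimately show ?case
      using card_of_singl_ordLeq F ordLeq_transitive by metis
  next
    case (Suc n)
    have "Fn (Suc n) \<subseteq> (\<lambda>(a,S). insert a S) ` (Field \<tau> \<times> Fn n)"
    proof
      fix S assume S: "S \<in> Fn (Suc n)"
      then have "S \<noteq> {}" by (auto simp: Fn_def)
      then obtain a where a: "a \<in> S" by blast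
      then have "S = (\<lambda>(a,S). insert a S) (a, S - {a})" "S - {a} \<in> Fn n" "a \<in> Field \<tau>"
        using S by (auto simp: Fn_def)
      then show "S \<in> (\<lambda>(a,S). insert a S) ` (Field \<tau> \<times> Fn n)" by (intro image_eqI[of S _ "(a, S - {a})"]) auto
    qed
    then have "|Fn (Suc n)| \<le>o |(\<lambda>(a,S). insert a S) ` (Field \<tau> \<times> Fn n)|"
      by (rule card_of_mono1)
    also have "|(\<lambda>(a,S). insert a S) ` (Field \<tau> \<times> Fn n)| \<le>o |Field \<tau> \<times> Fn n|"
      by (rule card_of_image)
    also have "|Field \<tau> \<times> Fn n| \<le>o \<tau>"
      by (rule card_of_Times_ordLeq_infinite_Field[OF inf F Suc tau(1)])
    finally show ?case .
  qed
  then have "|\<Union>n. Fn n| \<le>o \<tau>"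
    using card_of_UNION_ordLeq_infinite_Field[OF inf tau(1) nat, of Fn] by simp
  moreover have "Fpow (Field \<tau>) = (\<Union>n. Fn n)"
    by (auto simp: Fpow_def Fn_def)
  ultimately show ?thesis by simp
qed

lemma ordLeq_Times_nat:
  assumes tau: "Card_order \<tau>" "natLeq <o \<tau>" and B: "|B| \<le>o \<tau>"
  shows "|B \<times> (UNIV::nat set)| \<le>o \<tau>"
proof (rule card_of_Times_ordLeq_infinite_Field[OF _ B _ tau(1)])
  show "infinite (Field \<tau>)" by (rule infinite_Field[OF tau(2)])
  show "|UNIV::nat set| \<le>o \<tau>"
    using ordIso_ordLeq_trans[OF card_of_nat ordLess_imp_ordLeq[OF tau(2)]] .
qed

section \<open>Maps that avoid a $Z_\tau$-set\<close>

definition agreeing_maps :: "'k rel \<Rightarrow> 'k set \<Rightarrow> (('k \<Rightarrow> real) \<Rightarrow> 'k \<Rightarrow> real) set" where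
  "agreeing_maps \<tau> J = {g \<in> continuous_maps (cube \<tau>) (cube \<tau>).
     \<forall>x\<in>topspace (cube \<tau>). \<forall>k\<in>J. g x k = x k}"

text \<open>Covering a coordinate axis by intervals of length \<open>2/(n+1)\<close> with rational centres gives a countable
  cozero cover of the cube. Maps that are close with respect to all these covers, for all \<open>n\<close>, agree in that
  coordinate, so \<open>|J| \<cdot> \<omega> < \<tau>\<close> covers force agreement in all coordinates in \<open>J\<close>.\<close>

lemma open_agreeing_maps:
  assumes tau: "natLeq <o \<tau>" and J: "J \<subseteq> Field \<tau>" "|J| <o \<tau>"
  shows "open_in_C \<tau> (cube \<tau>) (cube \<tau>) (agreeing_maps \<tau> J)"
proof -
  define band where "band j n r = {y \<in> topspace (cube \<tau>). \<bar>y j - r\<bar> < 1 / Suc n}" for j n r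
  define T where "T = (\<lambda>(j,n). band j n ` \<rat>) ` (J \<times> (UNIV::nat set))"
  have cz: "cozero_in (cube \<tau>) (band j n r)" if "j \<in> J" for j n r
    unfolding cozero_in_def
  proof (intro exI conjI)
    show "continuous_map (cube \<tau>) euclideanreal (\<lambda>y. max 0 (1 / Suc n - \<bar>y j - r\<bar>))"
      using that J by (intro continuous_map_real_max continuous_map_real_abs continuous_map_diff
          continuous_map_cube_component continuous_map_canonical_const) auto
    show "band j n r = {y \<in> topspace (cube \<tau>). max 0 (1 / Suc n - \<bar>y j - r\<bar>) \<noteq> 0}"
      by (auto simp: band_def)
  qed
  have cover: "\<exists>r\<in>\<rat>. y \<in> band j n r" if "y \<in> topspace (cube \<tau>)" for y j n
  proof -
    obtain r where "r \<in> \<rat>" "y j < r" "r < y j + 1 / Suc n"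
      using Rats_dense_in_real[of "y j" "y j + 1 / Suc n"] by auto
    then show ?thesis using that by (intro bexI[of _ r]) (auto simp: band_def)
  qed
  have "T \<subseteq> cov (cube \<tau>)"
  proof (clarsimp simp: T_def cov_def)
    fix j n assume j: "j \<in> J"
    show "countable (band j n ` \<rat>) \<and> (\<forall>U\<in>\<rat>. cozero_in (cube \<tau>) (band j n U)) \<and>
       \<Union> (band j n ` \<rat>) = topspace (cube \<tau>)"
      using cover[of _ j n] by (auto simp: countable_rat cz[OF j]) (auto simp: band_def)
  qed
  moreover have "|T| <o \<tau>"
    unfolding T_def using ordLeq_ordLess_trans[OF card_of_image ordLess_Times_nat[OF tau J(2)]] .
  moreover have "g \<in> agreeing_maps \<tau> J"
    if h: "h \<in> agreeing_maps \<tau> J" and g: "g \<in> continuous_maps (cube \<tau>) (cube \<tau>)"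
      and close: "\<forall>\<U>\<in>T. cover_close (cube \<tau>) \<U> g h" for g h
  proof -
    have "g x j = x j" if x: "x \<in> topspace (cube \<tau>)" and j: "j \<in> J" for x j
    proof -
      have "\<bar>g x j - h x j\<bar> < 2 * (1 / Suc n)" for n
      proof -
        have "cover_close (cube \<tau>) (band j n ` \<rat>) g h"
          using close j by (auto simp: T_def)
        then obtain r where "g x \<in> band j n r" "h x \<in> band j n r"
          using x by (auto simp: cover_close_def)
        then show ?thesis by (auto simp: band_def)
      qed
      then have "\<bar>g x j - h x j\<bar> / 2 < 1 / Suc n" for n
        by (simp add: field_simps)
      then have "\<bar>g x j - h x j\<bar> / 2 \<le> 0"
        using nat_approx_posE[of "\<bar>g x j - h x j\<bar> / 2"] by (metis less_asym not_le)
      then have "g x j = h x j" by simp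
      then show ?thesis using h x j by (simp add: agreeing_maps_def)
    qed
    then show ?thesis using g by (simp add: agreeing_maps_def)
  qed
  ultimately show ?thesis
    unfolding open_in_C_def by (auto simp: agreeing_maps_def)
qed

lemma Z_set_closedin: "Z_set \<tau> X A \<Longrightarrow> closedin X A"
  by (simp add: Z_set_def)

lemma Z_set_subset: "Z_set \<tau> X A \<Longrightarrow> A \<subseteq> topspace X"
  by (simp add: Z_set_closedin closedin_subset)

text \<open>Density of the maps that avoid \<open>Y\<close>, applied to the open neighbourhood of the identity consisting of
  the maps that fix the coordinates in \<open>J\<close>.\<close>

lemma Z_set_avoiding_map:
  assumes tau: "Card_order \<tau>" "natLeq <o \<tau>" and Y: "Z_set \<tau> (cube \<tau>) Y"
    and J: "J \<subseteq> Field \<tau>" "|J| <o \<tau>"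
  shows "\<exists>s. continuous_map (cube \<tau>) (cube \<tau>) s \<and>
    (\<forall>x\<in>topspace (cube \<tau>). (\<forall>k\<in>J. s x k = x k) \<and> s x \<notin> Y)"
proof -
  let ?G = "agreeing_maps \<tau> J"
  have G: "openin (C_space \<tau> (cube \<tau>) (cube \<tau>)) ?G"
    unfolding openin_C_space[OF tau] by (rule open_agreeing_maps[OF tau(2) J])
  have id: "restrict id (topspace (cube \<tau>)) \<in> ?G"
    using J(1) continuous_map_eq[of "cube \<tau>" "cube \<tau>" id "restrict id (topspace (cube \<tau>))"]
    by (auto simp: agreeing_maps_def continuous_maps_def)
  have "restrict id (topspace (cube \<tau>)) \<in> topspace (C_space \<tau> (cube \<tau>) (cube \<tau>))"
    using openin_subset[OF G] id by blast
  then have "restrict id (topspace (cube \<tau>)) \<in> C_space \<tau> (cube \<tau>) (cube \<tau>) closure_of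
      {f \<in> continuous_maps (cube \<tau>) (cube \<tau>). f ` topspace (cube \<tau>) \<inter> Y = {}}"
    using Y by (simp add: Z_set_def)
  then obtain s where "s \<in> ?G" "s \<in> continuous_maps (cube \<tau>) (cube \<tau>)"
    "s ` topspace (cube \<tau>) \<inter> Y = {}"
    using G id unfolding in_closure_of by blast
  then show ?thesis
    by (intro exI[of _ s]) (auto simp: agreeing_maps_def continuous_maps_def)
qed

text \<open>The sets of pairs that differ in a given coordinate form an open cover of the compact set \<open>A \<times> B\<close>.\<close>

lemma finitely_many_coordinates_separate:
  assumes "compactin (cube \<tau>) A" "compactin (cube \<tau>) B" "A \<inter> B = {}"
  shows "\<exists>K. finite K \<and> K \<subseteq> Field \<tau> \<and> (\<forall>x\<in>A. \<forall>y\<in>B. \<exists>k\<in>K. x k \<noteq> y k)"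
proof -
  let ?P = "prod_topology (cube \<tau>) (cube \<tau>)"
  define D where "D k = {p \<in> topspace ?P. fst p k - snd p k \<in> - {0::real}}" for k
  have D_open: "openin ?P (D k)" if "k \<in> Field \<tau>" for k
    unfolding D_def
  proof (rule openin_continuous_map_preimage[where Y=euclideanreal])
    show "continuous_map ?P euclideanreal (\<lambda>p. fst p k - snd p k)"
      by (intro continuous_map_diff
          continuous_map_compose[OF continuous_map_fst continuous_map_cube_component[OF that], unfolded o_def]
          continuous_map_compose[OF continuous_map_snd continuous_map_cube_component[OF that], unfolded o_def])
  qed auto
  have sub: "A \<subseteq> topspace (cube \<tau>)" "B \<subseteq> topspace (cube \<tau>)"
    using assms by (auto dest: compactin_subset_topspace)
  have "A \<times> B \<subseteq> \<Union>(D ` Field \<tau>)"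
  proof clarify
    fix x y assume "x \<in> A" "y \<in> B"
    then show "(x,y) \<in> \<Union>(D ` Field \<tau>)"
      using assms(3) sub cube_eqI[of x \<tau> y] by (force simp: D_def)
  qed
  moreover have "compactin ?P (A \<times> B)"
    using assms by (simp add: compactin_Times)
  moreover have "openin ?P V" if "V \<in> D ` Field \<tau>" for V
    using that D_open by auto
  ultimately obtain \<F> where F: "finite \<F>" "\<F> \<subseteq> D ` Field \<tau>" "A \<times> B \<subseteq> \<Union>\<F>"
    using compactinD[of ?P "A \<times> B" "D ` Field \<tau>"] by auto
  then obtain K where K: "K \<subseteq> Field \<tau>" "finite K" "\<F> = D ` K"
    using finite_subset_image[OF F(1,2)] by auto
  have "\<exists>k\<in>K. x k \<noteq> y k" if "x \<in> A" "y \<in> B" for x y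
  proof -
    have "(x,y) \<in> \<Union>(D ` K)" using that F(3) K(3) by blast
    then obtain k where "k \<in> K" "(x,y) \<in> D k" by blast
    then show ?thesis by (auto simp: D_def)
  qed
  then show ?thesis using K by blast
qed

text \<open>Finitely many coordinates \<open>K\<close> already certify that \<open>s\<close> avoids \<open>Y\<close>: any point that agrees with some
  \<open>s x\<close> on \<open>K\<close> lies outside \<open>Y\<close>. This is what allows infinitely many such maps to be combined coordinate by
  coordinate.\<close>

lemma Z_set_coordinatewise_avoiding_map:
  assumes tau: "Card_order \<tau>" "natLeq <o \<tau>" and Y: "Z_set \<tau> (cube \<tau>) Y"
    and J: "J \<subseteq> Field \<tau>" "|J| <o \<tau>"
  shows "\<exists>s K. continuous_map (cube \<tau>) (cube \<tau>) s \<and>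
    (\<forall>x\<in>topspace (cube \<tau>). \<forall>k\<in>J. s x k = x k) \<and>
    finite K \<and> K \<subseteq> Field \<tau> \<and>
    (\<forall>x\<in>topspace (cube \<tau>). \<forall>y\<in>Y. \<exists>k\<in>K. s x k \<noteq> y k)"
proof -
  obtain s where s: "continuous_map (cube \<tau>) (cube \<tau>) s"
    "\<forall>x\<in>topspace (cube \<tau>). (\<forall>k\<in>J. s x k = x k) \<and> s x \<notin> Y"
    using Z_set_avoiding_map[OF assms] by (elim exE conjE)
  have "compactin (cube \<tau>) (s ` topspace (cube \<tau>))"
    using s(1) compact_space_cube image_compactin unfolding compact_space_def by blast
  moreover have "compactin (cube \<tau>) Y"
    using Y Z_set_closedin closedin_compact_space compact_space_cube by blast
  moreover have "s ` topspace (cube \<tau>) \<inter> Y = {}"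
    using s(2) by auto
  ultimately have "\<exists>K. finite K \<and> K \<subseteq> Field \<tau> \<and>
      (\<forall>x\<in>s ` topspace (cube \<tau>). \<forall>y\<in>Y. \<exists>k\<in>K. x k \<noteq> y k)"
    by (rule finitely_many_coordinates_separate)
  then obtain K where "finite K" "K \<subseteq> Field \<tau>"
    "\<forall>x\<in>s ` topspace (cube \<tau>). \<forall>y\<in>Y. \<exists>k\<in>K. x k \<noteq> y k"
    by (elim exE conjE)
  then show ?thesis using s by (intro exI[of _ s] exI[of _ K]) simp
qed

section \<open>Extending maps while avoiding a $Z_\tau$-set\<close>

text \<open>Transfinite recursion over \<open>\<tau>\<close>. At stage \<open>\<alpha>\<close> fewer than \<open>\<tau>\<close> coordinates \<open>J \<alpha>\<close> have been fixed, so there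
  is a map \<open>s \<alpha>\<close> that preserves them and pushes every point off \<open>Y\<close>, as certified by a finite set
  \<open>K \<alpha>\<close> of coordinates. The final values in the new coordinates \<open>K \<alpha> - J \<alpha>\<close> interpolate, by means of a
  Urysohn function \<open>u \<alpha>\<close>, between \<open>F0\<close> (on \<open>A\<close>) and the pushed point (on \<open>C \<alpha>\<close>). On \<open>C \<alpha>\<close> the result
  agrees on all of \<open>K \<alpha>\<close> with a point in the image of \<open>s \<alpha>\<close>, and later stages do not change this. Since
  continuity into a product is checked coordinatewise, a recursion of any length preserves it.\<close>

lemma extend_avoiding_Z_set:
  fixes \<tau> :: "'k rel" and T :: "'a topology"
  assumes tau: "Card_order \<tau>" "natLeq <o \<tau>" and Y: "Z_set \<tau> (cube \<tau>) Y"
    and T: "normal_space T" and A: "closedin T A"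
    and C: "\<And>\<alpha>. \<alpha> \<in> Field \<tau> \<Longrightarrow> closedin T (C \<alpha>) \<and> A \<inter> C \<alpha> = {}"
    and F0: "continuous_map T (cube \<tau>) F0"
  shows "\<exists>F. continuous_map T (cube \<tau>) F \<and> (\<forall>x\<in>A. F x = F0 x) \<and>
    (\<forall>\<alpha>\<in>Field \<tau>. \<forall>x\<in>C \<alpha>. F x \<notin> Y)"
proof -
  have F0_mem: "F0 x \<in> topspace (cube \<tau>)" if "x \<in> topspace T" for x
    using F0 that by (auto simp: continuous_map_cube_iff)
  have F0_cont: "continuous_map T euclideanreal (\<lambda>x. F0 x k)" if "k \<in> Field \<tau>" for k
    using F0 that by (auto simp: continuous_map_cube_iff)
  have "\<exists>u. continuous_map T (top_of_set {0..1::real}) u \<and> u ` A \<subseteq> {0} \<and> u ` C \<alpha> \<subseteq> {1}"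
    if "\<alpha> \<in> Field \<tau>" for \<alpha>
  proof (rule Urysohn_lemma[of T A "C \<alpha>" 0 1])
    show "disjnt A (C \<alpha>)" using C[OF that] by (simp add: disjnt_def)
  qed (use T A C[OF that] in auto)
  then obtain u where "\<forall>\<alpha>\<in>Field \<tau>. continuous_map T (top_of_set {0..1::real}) (u \<alpha>) \<and>
      u \<alpha> ` A \<subseteq> {0} \<and> u \<alpha> ` C \<alpha> \<subseteq> {1}"
    by metis
  then have u: "continuous_map T euclideanreal (u \<alpha>)" "\<And>x. x \<in> topspace T \<Longrightarrow> u \<alpha> x \<in> {0..1}"
      "\<And>x. x \<in> A \<Longrightarrow> u \<alpha> x = 0" "\<And>x. x \<in> C \<alpha> \<Longrightarrow> u \<alpha> x = 1"
    if "\<alpha> \<in> Field \<tau>" for \<alpha>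
    using that by (auto simp: continuous_map_in_subtopology image_subset_iff Pi_iff)
  define R where "R = \<tau> - Id"
  have wo: "well_order_on (Field \<tau>) \<tau>"
    using tau(1) by (rule card_order_on_well_order_on)
  then have wf: "wf R" by (simp add: R_def well_order_on_def)
  have tot: "\<alpha> = \<beta> \<or> (\<alpha>,\<beta>) \<in> R \<or> (\<beta>,\<alpha>) \<in> R" if "\<alpha> \<in> Field \<tau>" "\<beta> \<in> Field \<tau>" for \<alpha> \<beta>
    using wo that by (auto simp: R_def well_order_on_def linear_order_on_def total_on_def)
  have in_Field: "\<beta> \<in> Field \<tau>" if "(\<beta>,\<alpha>) \<in> R" for \<alpha> \<beta>
    using that by (auto simp: R_def Field_def)
  have small: "|{\<beta>. (\<beta>,\<alpha>) \<in> R}| <o \<tau>" if "\<alpha> \<in> Field \<tau>" for \<alpha>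
  proof -
    have "{\<beta>. (\<beta>,\<alpha>) \<in> R} = underS \<tau> \<alpha>" by (auto simp: R_def underS_def)
    then show ?thesis using card_of_underS[OF tau(1) that] by simp
  qed
  define good :: "'k set \<Rightarrow> (('k \<Rightarrow> real) \<Rightarrow> 'k \<Rightarrow> real) \<Rightarrow> 'k set \<Rightarrow> bool" where
    "good J s K \<longleftrightarrow> continuous_map (cube \<tau>) (cube \<tau>) s \<and>
      (\<forall>x\<in>topspace (cube \<tau>). \<forall>k\<in>J. s x k = x k) \<and> finite K \<and> K \<subseteq> Field \<tau> \<and>
      (\<forall>x\<in>topspace (cube \<tau>). \<forall>y\<in>Y. \<exists>k\<in>K. s x k \<noteq> y k)" for J s K
  \<comment> \<open>The pair \<open>f \<alpha> = (s \<alpha>, K \<alpha>)\<close> depends on the sets \<open>K \<beta>\<close> for \<open>\<beta>\<close> below \<open>\<alpha>\<close>, whose union is \<open>J \<alpha>\<close>.\<close>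
  have "\<exists>f. \<forall>\<alpha>. \<alpha> \<in> Field \<tau> \<longrightarrow> good (\<Union>\<beta>\<in>{\<beta>. (\<beta>,\<alpha>) \<in> R}. snd (f \<beta>)) (fst (f \<alpha>)) (snd (f \<alpha>))"
  proof (rule dependent_wf_choice[OF wf, where
        P = "\<lambda>f \<alpha> r. \<alpha> \<in> Field \<tau> \<longrightarrow> good (\<Union>\<beta>\<in>{\<beta>. (\<beta>,\<alpha>) \<in> R}. snd (f \<beta>)) (fst r) (snd r)"])
    fix f g :: "'k \<Rightarrow> (('k \<Rightarrow> real) \<Rightarrow> 'k \<Rightarrow> real) \<times> 'k set" and \<alpha> r
    assume "\<And>z. (z, \<alpha>) \<in> R \<Longrightarrow> f z = g z"
    then have "(\<Union>\<beta>\<in>{\<beta>. (\<beta>,\<alpha>) \<in> R}. snd (f \<beta>)) = (\<Union>\<beta>\<in>{\<beta>. (\<beta>,\<alpha>) \<in> R}. snd (g \<beta>))"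
      by auto
    then show "(\<alpha> \<in> Field \<tau> \<longrightarrow> good (\<Union>\<beta>\<in>{\<beta>. (\<beta>,\<alpha>) \<in> R}. snd (f \<beta>)) (fst r) (snd r)) =
       (\<alpha> \<in> Field \<tau> \<longrightarrow> good (\<Union>\<beta>\<in>{\<beta>. (\<beta>,\<alpha>) \<in> R}. snd (g \<beta>)) (fst r) (snd r))"
      by simp
  next
    fix \<alpha> and f :: "'k \<Rightarrow> (('k \<Rightarrow> real) \<Rightarrow> 'k \<Rightarrow> real) \<times> 'k set"
    assume IH: "\<And>\<beta>. (\<beta>,\<alpha>) \<in> R \<Longrightarrow>
      \<beta> \<in> Field \<tau> \<longrightarrow> good (\<Union>\<gamma>\<in>{\<gamma>. (\<gamma>,\<beta>) \<in> R}. snd (f \<gamma>)) (fst (f \<beta>)) (snd (f \<beta>))"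
    let ?J = "\<Union>\<beta>\<in>{\<beta>. (\<beta>,\<alpha>) \<in> R}. snd (f \<beta>)"
    have K: "finite (snd (f \<beta>))" "snd (f \<beta>) \<subseteq> Field \<tau>" if "(\<beta>,\<alpha>) \<in> R" for \<beta>
      using IH[OF that] in_Field[OF that] by (auto simp: good_def)
    show "\<exists>r. \<alpha> \<in> Field \<tau> \<longrightarrow> good ?J (fst r) (snd r)"
    proof (cases "\<alpha> \<in> Field \<tau>")
      case True
      have "|?J| <o \<tau>"
        by (intro ordLess_UNION_finite tau small True) (use K in auto)
      moreover have "?J \<subseteq> Field \<tau>" using K by auto
      ultimately have "\<exists>s K. good ?J s K"
        unfolding good_def by (intro Z_set_coordinatewise_avoiding_map tau Y)
      then show ?thesis by auto
    qed auto
  qed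
  then obtain f where f: "\<forall>\<alpha>. \<alpha> \<in> Field \<tau> \<longrightarrow>
      good (\<Union>\<beta>\<in>{\<beta>. (\<beta>,\<alpha>) \<in> R}. snd (f \<beta>)) (fst (f \<alpha>)) (snd (f \<alpha>))" by (rule exE)
  define s where "s \<alpha> = fst (f \<alpha>)" for \<alpha>
  define K where "K \<alpha> = snd (f \<alpha>)" for \<alpha>
  define J where "J \<alpha> = (\<Union>\<beta>\<in>{\<beta>. (\<beta>,\<alpha>) \<in> R}. K \<beta>)" for \<alpha>
  have good: "good (J \<alpha>) (s \<alpha>) (K \<alpha>)" if "\<alpha> \<in> Field \<tau>" for \<alpha>
    using f that by (simp add: s_def K_def J_def)
  have s_cont: "continuous_map (cube \<tau>) (cube \<tau>) (s \<alpha>)"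
    and s_fix: "\<And>x k. x \<in> topspace (cube \<tau>) \<Longrightarrow> k \<in> J \<alpha> \<Longrightarrow> s \<alpha> x k = x k"
    and s_avoid: "\<And>x y. x \<in> topspace (cube \<tau>) \<Longrightarrow> y \<in> Y \<Longrightarrow> \<exists>k\<in>K \<alpha>. s \<alpha> x k \<noteq> y k"
    and K_Field: "K \<alpha> \<subseteq> Field \<tau>"
    if "\<alpha> \<in> Field \<tau>" for \<alpha>
    using good[OF that] unfolding good_def by auto
  \<comment> \<open>The sets \<open>K \<alpha> - J \<alpha>\<close> are pairwise disjoint; \<open>first k\<close> is the stage at which coordinate \<open>k\<close> is fixed.\<close>
  have "\<exists>first. \<forall>k. \<forall>\<alpha>\<in>Field \<tau>. k \<in> K \<alpha> - J \<alpha> \<longrightarrow> first k = \<alpha>"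
  proof -
    have "\<alpha> = \<beta>" if "\<alpha> \<in> Field \<tau>" "\<beta> \<in> Field \<tau>" "k \<in> K \<alpha> - J \<alpha>" "k \<in> K \<beta> - J \<beta>" for \<alpha> \<beta> k
      using tot[OF that(1,2)] that(3,4) by (auto simp: J_def)
    then have "\<forall>\<alpha>\<in>Field \<tau>. k \<in> K \<alpha> - J \<alpha> \<longrightarrow> (SOME \<beta>. \<beta> \<in> Field \<tau> \<and> k \<in> K \<beta> - J \<beta>) = \<alpha>" for k
      by (metis (mono_tags, lifting) someI_ex)
    then show ?thesis by (intro exI[of _ "\<lambda>k. SOME \<beta>. \<beta> \<in> Field \<tau> \<and> k \<in> K \<beta> - J \<beta>"]) blast
  qed
  then obtain first where first: "\<And>k \<alpha>. \<alpha> \<in> Field \<tau> \<Longrightarrow> k \<in> K \<alpha> - J \<alpha> \<Longrightarrow> first k = \<alpha>"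
    by auto
  have first_ex: "\<exists>\<beta>. (\<beta>,\<alpha>) \<in> R \<and> k \<in> K \<beta> - J \<beta>" if "k \<in> J \<alpha>" for k \<alpha>
  proof -
    define Q where "Q = {\<beta>. (\<beta>,\<alpha>) \<in> R \<and> k \<in> K \<beta>}"
    have "Q \<noteq> {}" using that by (auto simp: Q_def J_def)
    then obtain \<beta> where b: "\<beta> \<in> Q" "\<And>\<gamma>. (\<gamma>,\<beta>) \<in> R \<Longrightarrow> \<gamma> \<notin> Q"
      using wf wfE_min[of R] by (metis all_not_in_conv)
    have "trans R"
      using wo unfolding R_def well_order_on_def linear_order_on_def partial_order_on_def preorder_on_def
      by (simp add: trans_diff_Id)
    then have "k \<notin> J \<beta>"
      using b unfolding J_def Q_def by (auto dest: transD)
    then show ?thesis using b(1) by (auto simp: Q_def)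
  qed
  \<comment> \<open>The provisional map at stage \<open>\<alpha>\<close>: final values in the coordinates \<open>J \<alpha>\<close>, the values of \<open>F0\<close> elsewhere.\<close>
  define stage :: "('k \<Rightarrow> 'a \<Rightarrow> 'k \<Rightarrow> real) \<Rightarrow> 'k \<Rightarrow> 'a \<Rightarrow> 'k \<Rightarrow> real" where
    "stage G \<alpha> x = (\<lambda>k. if k \<in> J \<alpha> then G (first k) x k else F0 x k)" for G \<alpha> x
  \<comment> \<open>The outcome \<open>G \<alpha>\<close> of stage \<open>\<alpha>\<close> supplies the final values in the coordinates \<open>K \<alpha> - J \<alpha>\<close>.\<close>
  have "\<exists>G. \<forall>\<alpha>. G \<alpha> = (\<lambda>x k. (1 - u \<alpha> x) * F0 x k + u \<alpha> x * s \<alpha> (stage G \<alpha> x) k)"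
  proof (rule dependent_wf_choice[OF wf, where
        P = "\<lambda>G \<alpha> r. r = (\<lambda>x k. (1 - u \<alpha> x) * F0 x k + u \<alpha> x * s \<alpha> (stage G \<alpha> x) k)"])
    fix G H :: "'k \<Rightarrow> 'a \<Rightarrow> 'k \<Rightarrow> real" and \<alpha> r
    assume eq: "\<And>z. (z, \<alpha>) \<in> R \<Longrightarrow> G z = H z"
    have "G (first k) = H (first k)" if "k \<in> J \<alpha>" for k
    proof -
      obtain \<beta> where "(\<beta>,\<alpha>) \<in> R" "k \<in> K \<beta> - J \<beta>" using first_ex[OF \<open>k \<in> J \<alpha>\<close>] by auto
      then show ?thesis using first[of \<beta> k] in_Field eq by simp
    qed
    then have "stage G \<alpha> = stage H \<alpha>"
      by (auto simp: stage_def fun_eq_iff)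
    then show "(r = (\<lambda>x k. (1 - u \<alpha> x) * F0 x k + u \<alpha> x * s \<alpha> (stage G \<alpha> x) k)) =
       (r = (\<lambda>x k. (1 - u \<alpha> x) * F0 x k + u \<alpha> x * s \<alpha> (stage H \<alpha> x) k))" by simp
  qed blast
  then obtain G where G: "\<And>\<alpha>. G \<alpha> = (\<lambda>x k. (1 - u \<alpha> x) * F0 x k + u \<alpha> x * s \<alpha> (stage G \<alpha> x) k)"
    by auto
  define F where "F x k = (if k \<in> (\<Union>\<alpha>\<in>Field \<tau>. K \<alpha>) then G (first k) x k else F0 x k)" for x k
  have stage_eq: "stage G \<alpha> x = (\<lambda>k. if k \<in> J \<alpha> then F x k else F0 x k)" for \<alpha> x
    unfolding stage_def F_def J_def using in_Field by (intro ext) auto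
  have F_step: "F x k = (1 - u \<alpha> x) * F0 x k + u \<alpha> x * s \<alpha> (stage G \<alpha> x) k"
    if "\<alpha> \<in> Field \<tau>" "k \<in> K \<alpha> - J \<alpha>" for x k \<alpha>
  proof -
    have "F x k = G (first k) x k" using that by (auto simp: F_def)
    also have "\<dots> = G \<alpha> x k" using first[OF that] by simp
    also have "\<dots> = (1 - u \<alpha> x) * F0 x k + u \<alpha> x * s \<alpha> (stage G \<alpha> x) k"
      by (subst G) (rule refl)
    finally show ?thesis .
  qed
  have block_ex: "\<exists>\<beta>. \<beta> \<in> Field \<tau> \<and> k \<in> K \<beta> - J \<beta>" if "k \<in> K \<alpha>" "\<alpha> \<in> Field \<tau>" for k \<alpha>
    using first_ex[of k \<alpha>] in_Field that by blast
  define nice where "nice k \<longleftrightarrow> continuous_map T euclideanreal (\<lambda>x. F x k) \<and>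
      (\<forall>x\<in>topspace T. F x k \<in> {0..1})" for k
  have stage_cont: "continuous_map T (cube \<tau>) (stage G \<alpha>)"
    if "\<alpha> \<in> Field \<tau>" "\<And>k. k \<in> J \<alpha> \<Longrightarrow> nice k" for \<alpha>
    unfolding continuous_map_cube_iff
  proof (intro conjI ballI funcsetI)
    fix x assume x: "x \<in> topspace T"
    have "J \<alpha> \<subseteq> Field \<tau>" using K_Field in_Field by (fastforce simp: J_def)
    then show "stage G \<alpha> x \<in> topspace (cube \<tau>)"
      using that(2) F0_mem[OF x] x by (auto simp: stage_eq topspace_cube PiE_iff extensional_def nice_def)
  next
    fix k assume "k \<in> Field \<tau>"
    then show "continuous_map T euclideanreal (\<lambda>x. stage G \<alpha> x k)"
      using that(2)[of k] F0_cont by (cases "k \<in> J \<alpha>") (auto simp: stage_eq nice_def)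
  qed
  have nice_K: "\<alpha> \<in> Field \<tau> \<longrightarrow> (\<forall>k\<in>K \<alpha>. nice k)" for \<alpha>
    using wf
  proof (induction \<alpha> rule: wf_induct_rule)
    case (less \<alpha>)
    show ?case
    proof (intro impI ballI)
      fix k assume a: "\<alpha> \<in> Field \<tau>" and k: "k \<in> K \<alpha>"
      have nice_J: "nice k" if "k \<in> J \<alpha>" for k
        using that less.IH in_Field by (auto simp: J_def)
      show "nice k"
      proof (cases "k \<in> J \<alpha>")
        case False
        have kF: "k \<in> Field \<tau>" using K_Field[OF a] k by blast
        have st: "continuous_map T (cube \<tau>) (s \<alpha> \<circ> stage G \<alpha>)"
          using continuous_map_compose[OF stage_cont[OF a nice_J] s_cont[OF a]] .
        then have st1: "continuous_map T euclideanreal (\<lambda>x. s \<alpha> (stage G \<alpha> x) k)"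
          and st2: "\<And>x. x \<in> topspace T \<Longrightarrow> s \<alpha> (stage G \<alpha> x) \<in> topspace (cube \<tau>)"
          using kF by (auto simp: continuous_map_cube_iff)
        have eq: "(\<lambda>x. F x k) = (\<lambda>x. (1 - u \<alpha> x) * F0 x k + u \<alpha> x * s \<alpha> (stage G \<alpha> x) k)"
          using F_step[OF a] k False by auto
        show ?thesis unfolding nice_def
        proof
          show "continuous_map T euclideanreal (\<lambda>x. F x k)"
            unfolding eq using u(1)[OF a] F0_cont[OF kF] st1
            by (intro continuous_map_add continuous_map_real_mult continuous_map_diff) auto
          show "\<forall>x\<in>topspace T. F x k \<in> {0..1}"
          proof
            fix x assume x: "x \<in> topspace T"
            have "F x k = (1 - u \<alpha> x) * F0 x k + u \<alpha> x * s \<alpha> (stage G \<alpha> x) k"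
              using eq by metis
            then show "F x k \<in> {0..1}"
              using convexD_alt[OF convex_real_interval(5), of "F0 x k" 0 1 "s \<alpha> (stage G \<alpha> x) k" "u \<alpha> x"]
                u(2)[OF a x] cube_component_bounds[OF F0_mem[OF x] kF]
                cube_component_bounds[OF st2[OF x] kF] by simp
          qed
        qed
      qed (rule nice_J)
    qed
  qed
  have "continuous_map T (cube \<tau>) F"
    unfolding continuous_map_cube_iff
  proof (intro conjI ballI funcsetI)
    fix x assume x: "x \<in> topspace T"
    have "F x k = F0 x k" if "k \<notin> (\<Union>\<alpha>\<in>Field \<tau>. K \<alpha>)" for k
      using that by (simp add: F_def)
    moreover have "k \<in> Field \<tau> \<and> F x k \<in> {0..1}" if "k \<in> (\<Union>\<alpha>\<in>Field \<tau>. K \<alpha>)" for k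
      using that K_Field nice_K x by (auto simp: nice_def)
    moreover have "k \<in> Field \<tau> \<Longrightarrow> F0 x k \<in> {0..1}" "k \<notin> Field \<tau> \<Longrightarrow> F0 x k = undefined" for k
      using F0_mem[OF x] unfolding topspace_cube by (auto simp: PiE_iff extensional_def)
    ultimately have "k \<in> Field \<tau> \<Longrightarrow> F x k \<in> {0..1}" "k \<notin> Field \<tau> \<Longrightarrow> F x k = undefined" for k
      by metis+
    then show "F x \<in> topspace (cube \<tau>)"
      by (simp add: topspace_cube PiE_iff extensional_def)
  next
    fix k assume k: "k \<in> Field \<tau>"
    show "continuous_map T euclideanreal (\<lambda>x. F x k)"
    proof (cases "k \<in> (\<Union>\<alpha>\<in>Field \<tau>. K \<alpha>)")
      case True
      then show ?thesis using nice_K by (auto simp: nice_def)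
    next
      case False
      then show ?thesis using F0_cont[OF k] by (simp add: F_def)
    qed
  qed
  moreover have "F x = F0 x" if "x \<in> A" for x
  proof
    fix k
    show "F x k = F0 x k"
    proof (cases "k \<in> (\<Union>\<alpha>\<in>Field \<tau>. K \<alpha>)")
      case True
      then obtain \<alpha> where "\<alpha> \<in> Field \<tau>" "k \<in> K \<alpha> - J \<alpha>" using block_ex by blast
      then show ?thesis using F_step[of \<alpha> k x] u(3)[of \<alpha> x] that by simp
    qed (simp add: F_def)
  qed
  moreover have "F x \<notin> Y" if a: "\<alpha> \<in> Field \<tau>" and x: "x \<in> C \<alpha>" for \<alpha> x
  proof
    assume "F x \<in> Y"
    have xT: "x \<in> topspace T" using C[OF a] x closedin_subset by blast
    have st: "stage G \<alpha> x \<in> topspace (cube \<tau>)"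
      using stage_cont[OF a] nice_K in_Field xT by (force simp: J_def continuous_map_def)
    then obtain k where k: "k \<in> K \<alpha>" "s \<alpha> (stage G \<alpha> x) k \<noteq> F x k"
      using s_avoid[OF a _ \<open>F x \<in> Y\<close>] by blast
    have "F x k = s \<alpha> (stage G \<alpha> x) k"
    proof (cases "k \<in> J \<alpha>")
      case True
      then show ?thesis using s_fix[OF a st] by (simp add: stage_eq)
    next
      case False
      then show ?thesis using F_step[OF a, of k x] u(4)[OF a x] k(1) by simp
    qed
    then show False using k(2) by simp
  qed
  ultimately show ?thesis by blast
qed

text \<open>The open sets over which the recursion above can be carried out.\<close>

definition closed_union :: "'k rel \<Rightarrow> 'a topology \<Rightarrow> 'a set \<Rightarrow> bool" where
  "closed_union \<tau> T U \<longleftrightarrow> (\<exists>\<D>. |\<D>| \<le>o \<tau> \<and> (\<forall>D\<in>\<D>. closedin T D) \<and> \<Union>\<D> = U)"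

text \<open>By compactness, a point outside \<open>X\<close> keeps a distance of at least \<open>1/(n+1)\<close> from each point of \<open>X\<close> in one of
  finitely many coordinates \<open>S\<close>, where \<open>S\<close> and \<open>n\<close> depend on the point only. There are \<open>\<tau>\<close> choices of
  \<open>(S, n)\<close>, and each defines a closed set.\<close>

lemma closed_union_cube_compl:
  assumes tau: "Card_order \<tau>" "natLeq <o \<tau>" and X: "closedin (cube \<tau>) X"
  shows "closed_union \<tau> (cube \<tau>) (topspace (cube \<tau>) - X)"
proof -
  have Xsub: "X \<subseteq> topspace (cube \<tau>)" using X closedin_subset by blast
  define D where "D S n = {x \<in> topspace (cube \<tau>). \<forall>y\<in>X. \<exists>k\<in>S. 1 / Suc n \<le> \<bar>x k - y k\<bar>}"
    for S and n :: nat
  define \<D> where "\<D> = (\<lambda>(S,n). D S n) ` (Fpow (Field \<tau>) \<times> UNIV)"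
  have closed: "closedin (cube \<tau>) (D S n)" if S: "S \<in> Fpow (Field \<tau>)" for S n
  proof -
    have one: "closedin (cube \<tau>) {x \<in> topspace (cube \<tau>). \<exists>k\<in>S. 1 / Suc n \<le> \<bar>x k - y k\<bar>}" for y
    proof -
      have "closedin (cube \<tau>) {x \<in> topspace (cube \<tau>). \<bar>x k - y k\<bar> \<in> {1 / Suc n..}}" if "k \<in> S" for k
      proof (rule closedin_continuous_map_preimage[where Y=euclideanreal])
        have "k \<in> Field \<tau>" using that S by (auto simp: Fpow_def)
        then show "continuous_map (cube \<tau>) euclideanreal (\<lambda>x. \<bar>x k - y k\<bar>)"
          by (intro continuous_map_real_abs[OF continuous_map_diff[OF
                continuous_map_cube_component continuous_map_canonical_const]])
      qed auto
      then have "closedin (cube \<tau>) (\<Union>k\<in>S. {x \<in> topspace (cube \<tau>). \<bar>x k - y k\<bar> \<in> {1 / Suc n..}})"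
        using S by (intro closedin_Union) (auto simp: Fpow_def)
      moreover have "(\<Union>k\<in>S. {x \<in> topspace (cube \<tau>). \<bar>x k - y k\<bar> \<in> {1 / Suc n..}})
          = {x \<in> topspace (cube \<tau>). \<exists>k\<in>S. 1 / Suc n \<le> \<bar>x k - y k\<bar>}" by auto
      ultimately show ?thesis by simp
    qed
    have "closedin (cube \<tau>) (\<Inter>(insert (topspace (cube \<tau>))
        ((\<lambda>y. {x \<in> topspace (cube \<tau>). \<exists>k\<in>S. 1 / Suc n \<le> \<bar>x k - y k\<bar>}) ` X)))"
      by (rule closedin_Inter) (use one in auto)
    moreover have "\<Inter>(insert (topspace (cube \<tau>))
        ((\<lambda>y. {x \<in> topspace (cube \<tau>). \<exists>k\<in>S. 1 / Suc n \<le> \<bar>x k - y k\<bar>}) ` X)) = D S n"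
      by (auto simp: D_def)
    ultimately show ?thesis by simp
  qed
  have sub: "D S n \<subseteq> topspace (cube \<tau>) - X" for S n
    by (force simp: D_def)
  have "\<exists>S\<in>Fpow (Field \<tau>). \<exists>n. x \<in> D S n" if x: "x \<in> topspace (cube \<tau>)" "x \<notin> X" for x
  proof -
    define V where "V p = {y \<in> topspace (cube \<tau>). y (fst p) - x (fst p) \<in> {r. 1 / Suc (snd p) < \<bar>r\<bar>}}"
      for p :: "'a \<times> nat"
    have V: "openin (cube \<tau>) (V p)" if "p \<in> Field \<tau> \<times> UNIV" for p
      unfolding V_def
    proof (rule openin_continuous_map_preimage[where Y=euclideanreal])
      show "continuous_map (cube \<tau>) euclideanreal (\<lambda>y. y (fst p) - x (fst p))"
        using that by (intro continuous_map_diff[OF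
                continuous_map_cube_component continuous_map_canonical_const]) auto
      show "openin euclideanreal {r. 1 / Suc (snd p) < \<bar>r\<bar>}"
        by (auto intro!: open_Collect_less continuous_intros)
    qed
    have "X \<subseteq> \<Union>(V ` (Field \<tau> \<times> UNIV))"
    proof
      fix y assume y: "y \<in> X"
      then obtain k where k: "k \<in> Field \<tau>" "y k \<noteq> x k"
        using x Xsub cube_eqI[of y \<tau> x] by blast
      then obtain n where "1 / Suc n < \<bar>y k - x k\<bar>"
        using nat_approx_posE[of "\<bar>y k - x k\<bar>"] by auto
      then have "y \<in> V (k,n)" using y Xsub by (auto simp: V_def)
      then show "y \<in> \<Union>(V ` (Field \<tau> \<times> UNIV))" using k by blast
    qed
    moreover have "compactin (cube \<tau>) X"
      using X closedin_compact_space compact_space_cube by blast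
    moreover have "openin (cube \<tau>) W" if "W \<in> V ` (Field \<tau> \<times> UNIV)" for W
      using that V by auto
    ultimately obtain \<F> where F: "finite \<F>" "\<F> \<subseteq> V ` (Field \<tau> \<times> UNIV)" "X \<subseteq> \<Union>\<F>"
      using compactinD[of "cube \<tau>" X "V ` (Field \<tau> \<times> UNIV)"] by auto
    then obtain Q where Q: "Q \<subseteq> Field \<tau> \<times> UNIV" "finite Q" "\<F> = V ` Q"
      using finite_subset_image[OF F(1,2)] by auto
    define n where "n = Max (insert 0 (snd ` Q))"
    have "x \<in> D (fst ` Q) n"
    proof -
      have "\<exists>k\<in>fst ` Q. 1 / Suc n \<le> \<bar>x k - y k\<bar>" if "y \<in> X" for y
      proof -
        have "y \<in> \<Union>(V ` Q)" using F(3) Q(3) that by blast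
        then obtain p where p: "p \<in> Q" "y \<in> V p" by blast
        have "snd p \<le> n" unfolding n_def using p(1) Q(2) by (intro Max_ge) auto
        then have "1 / Suc n \<le> 1 / Suc (snd p)" by (simp add: frac_le)
        also have "\<dots> \<le> \<bar>x (fst p) - y (fst p)\<bar>" using p(2) by (auto simp: V_def)
        finally show ?thesis using p(1) by blast
      qed
      then show ?thesis using x by (simp add: D_def)
    qed
    moreover have "fst ` Q \<in> Fpow (Field \<tau>)" using Q by (auto simp: Fpow_def)
    ultimately show ?thesis by blast
  qed
  then have "\<Union>\<D> = topspace (cube \<tau>) - X"
    using sub unfolding \<D>_def by auto
  moreover have "|\<D>| \<le>o \<tau>"
    unfolding \<D>_def
    by (rule ordLeq_transitive[OF card_of_image ordLeq_Times_nat[OF tau card_Fpow_ordLeq[OF tau]]])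
  moreover have "\<forall>D\<in>\<D>. closedin (cube \<tau>) D" using closed by (auto simp: \<D>_def)
  ultimately show ?thesis unfolding closed_union_def by blast
qed

lemma closed_union_open_interval_Times:
  assumes tau: "Card_order \<tau>" "natLeq <o \<tau>" and U: "closed_union \<tau> T U"
  shows "closed_union \<tau> (prod_topology (top_of_set {0..1::real}) T) ({0<..<1} \<times> U)"
proof -
  obtain \<D> where D: "|\<D>| \<le>o \<tau>" "\<forall>D\<in>\<D>. closedin T D" "\<Union>\<D> = U"
    using U by (auto simp: closed_union_def)
  define \<E> where "\<E> = (\<lambda>(D,n). {1 / Suc n .. 1 - 1 / Suc n} \<times> D) ` (\<D> \<times> (UNIV::nat set))"
  have "closedin (top_of_set {0..1::real}) {1 / Suc n .. 1 - 1 / Suc n}" for n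
    by (intro closed_subset) auto
  then have "\<forall>E\<in>\<E>. closedin (prod_topology (top_of_set {0..1::real}) T) E"
    using D(2) unfolding \<E>_def by (auto simp: closedin_prod_Times_iff)
  moreover have "|\<E>| \<le>o \<tau>"
    unfolding \<E>_def by (rule ordLeq_transitive[OF card_of_image ordLeq_Times_nat[OF tau D(1)]])
  moreover have "\<Union>\<E> = {0<..<1} \<times> U"
  proof -
    have "(\<Union>n. {1 / Suc n .. 1 - 1 / Suc n}) = {0<..<1::real}"
    proof (intro subset_antisym subsetI)
      fix t :: real assume "t \<in> {0<..<1}"
      then obtain n where "1 / Suc n < min t (1 - t)"
        using nat_approx_posE[of "min t (1 - t)"] by auto
      then show "t \<in> (\<Union>n. {1 / Suc n .. 1 - 1 / Suc n})" by (auto intro!: exI[of _ n])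
    next
      fix t :: real assume "t \<in> (\<Union>n. {1 / Suc n .. 1 - 1 / Suc n})"
      then obtain n where "1 / Suc n \<le> t" "t \<le> 1 - 1 / Suc n" by auto
      moreover have "0 < 1 / real (Suc n)" by simp
      ultimately show "t \<in> {0<..<1}" unfolding greaterThanLessThan_iff by linarith
    qed
    then show ?thesis unfolding \<E>_def using D(3) by blast
  qed
  ultimately show ?thesis unfolding closed_union_def by blast
qed

lemma Tietze_extension_cube:
  assumes T: "normal_space T" and A: "closedin T A"
    and f: "continuous_map (subtopology T A) (cube \<tau>) f"
  shows "\<exists>F. continuous_map T (cube \<tau>) F \<and> (\<forall>x\<in>A. F x = f x)"
proof -
  have Asub: "A \<subseteq> topspace T" using A closedin_subset by blast
  have fmem: "f x \<in> topspace (cube \<tau>)" if "x \<in> A" for x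
    using f that Asub by (auto simp: continuous_map_cube_iff)
  have "\<exists>g. continuous_map T euclideanreal g \<and> (\<forall>x\<in>A. g x = f x k) \<and> g ` topspace T \<subseteq> {0..1}"
    if k: "k \<in> Field \<tau>" for k
  proof (rule Tietze_extension_closed_real_interval[OF T A, of "\<lambda>x. f x k" 0 1])
    show "continuous_map (subtopology T A) euclideanreal (\<lambda>x. f x k)"
      using f k by (auto simp: continuous_map_cube_iff)
    show "(\<lambda>x. f x k) ` A \<subseteq> {0..1}"
      using cube_component_bounds[OF fmem k] by auto
  qed auto
  then obtain g where g: "\<forall>k\<in>Field \<tau>. continuous_map T euclideanreal (g k) \<and>
      (\<forall>x\<in>A. g k x = f x k) \<and> g k ` topspace T \<subseteq> {0..1}"
    by metis
  define F where "F x = (\<lambda>k\<in>Field \<tau>. g k x)" for x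
  have "continuous_map T (cube \<tau>) F"
    unfolding continuous_map_cube_iff using g
    by (auto simp: F_def topspace_cube image_subset_iff PiE_iff)
  moreover have "F x = f x" if x: "x \<in> A" for x
  proof (rule cube_eqI[OF _ fmem[OF x]])
    show "F x \<in> topspace (cube \<tau>)"
      using calculation x Asub by (auto simp: continuous_map_cube_iff)
    show "F x k = f x k" if "k \<in> Field \<tau>" for k
      using g that x by (simp add: F_def)
  qed
  ultimately show ?thesis by blast
qed

text \<open>Tietze extension followed by the recursive correction.\<close>

lemma Tietze_extension_avoiding_Z_set:
  assumes tau: "Card_order \<tau>" "natLeq <o \<tau>" and Y: "Z_set \<tau> (cube \<tau>) Y"
    and T: "normal_space T" and A: "closedin T A"
    and U: "closed_union \<tau> T (topspace T - A)"
    and f: "continuous_map (subtopology T A) (cube \<tau>) f"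
  shows "\<exists>F. continuous_map T (cube \<tau>) F \<and> (\<forall>x\<in>A. F x = f x) \<and>
    (\<forall>x\<in>topspace T - A. F x \<notin> Y)"
proof -
  obtain F0 where F0: "continuous_map T (cube \<tau>) F0" "\<forall>x\<in>A. F0 x = f x"
    using Tietze_extension_cube[OF T A f] by blast
  obtain \<D> where D: "|\<D>| \<le>o \<tau>" "\<forall>D\<in>\<D>. closedin T D" "\<Union>\<D> = topspace T - A"
    using U by (auto simp: closed_union_def)
  \<comment> \<open>Enumerate \<open>\<D>\<close> along \<open>\<tau>\<close>; the empty set is a harmless value when there is nothing to enumerate.\<close>
  have "\<exists>C. \<D> \<subseteq> C ` Field \<tau> \<and> (\<forall>\<alpha>\<in>Field \<tau>. C \<alpha> \<in> insert {} \<D>)"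
  proof (cases "\<D> = {}")
    case False
    have "|\<D>| \<le>o |Field \<tau>|"
      using D(1) card_of_Field_ordIso[OF tau(1)] ordIso_symmetric ordLeq_ordIso_trans by blast
    then have "\<exists>C. C ` Field \<tau> = \<D>"
      by (rule iffD2[OF card_of_ordLeq2[OF False]])
    then obtain C where "C ` Field \<tau> = \<D>" by (rule exE)
    then show ?thesis by (intro exI[of _ C]) auto
  qed auto
  then obtain C where C: "\<D> \<subseteq> C ` Field \<tau>" "\<forall>\<alpha>\<in>Field \<tau>. C \<alpha> \<in> insert {} \<D>"
    by blast
  have disj: "closedin T (C \<alpha>) \<and> A \<inter> C \<alpha> = {}" if "\<alpha> \<in> Field \<tau>" for \<alpha>
  proof -
    have "C \<alpha> = {} \<or> C \<alpha> \<in> \<D>" using C(2) that by blast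
    then show ?thesis using D(2,3) by auto
  qed
  have "\<exists>F. continuous_map T (cube \<tau>) F \<and> (\<forall>x\<in>A. F x = F0 x) \<and>
      (\<forall>\<alpha>\<in>Field \<tau>. \<forall>x\<in>C \<alpha>. F x \<notin> Y)"
    by (rule extend_avoiding_Z_set[OF tau Y T A disj F0(1)])
  then obtain F where
    F: "continuous_map T (cube \<tau>) F" "\<forall>x\<in>A. F x = F0 x" "\<forall>\<alpha>\<in>Field \<tau>. \<forall>x\<in>C \<alpha>. F x \<notin> Y"
    by (elim exE conjE)
  have "F x \<notin> Y" if "x \<in> topspace T - A" for x
  proof -
    have "x \<in> \<Union>\<D>" using that D(3) by simp
    then obtain E where "E \<in> \<D>" "x \<in> E" by (rule UnionE)
    moreover from this obtain \<alpha> where "\<alpha> \<in> Field \<tau>" "E = C \<alpha>" using C(1) by (auto dest: subsetD)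
    ultimately show ?thesis using F(3) by blast
  qed
  then show ?thesis using F F0(2) by (intro exI[of _ F]) auto
qed

section \<open>Extending maps from the complement of a $Z_\tau$-set\<close>

definition cylinder :: "'k rel \<Rightarrow> (real \<times> ('k \<Rightarrow> real)) topology" where
  "cylinder \<tau> = prod_topology (top_of_set {0..1}) (cube \<tau>)"

lemma topspace_cylinder: "topspace (cylinder \<tau>) = {0..1} \<times> topspace (cube \<tau>)"
  by (simp add: cylinder_def)

definition small_box :: "'k rel \<Rightarrow> 'k set \<Rightarrow> real \<Rightarrow> real \<times> ('k \<Rightarrow> real) \<Rightarrow> (real \<times> ('k \<Rightarrow> real)) set" where
  "small_box \<tau> S d p = {q \<in> topspace (cylinder \<tau>).
     \<bar>fst q - fst p\<bar> < d \<and> (\<forall>k\<in>S. \<bar>snd q k - snd p k\<bar> < d)}"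

lemma openin_small_box:
  assumes "finite S" "S \<subseteq> Field \<tau>"
  shows "openin (cylinder \<tau>) (small_box \<tau> S d p)"
proof -
  have "openin (cylinder \<tau>) {q \<in> topspace (cylinder \<tau>). fst q \<in> ball (fst p) d}"
  proof (rule openin_continuous_map_preimage[where Y=euclideanreal])
    show "continuous_map (cylinder \<tau>) euclideanreal fst"
      using continuous_map_fst[of "top_of_set {0..1::real}" "cube \<tau>"]
      by (auto simp: cylinder_def continuous_map_in_subtopology)
  qed auto
  moreover have "openin (cylinder \<tau>) {q \<in> topspace (cylinder \<tau>). snd q k \<in> ball (snd p k) d}"
    if "k \<in> S" for k
  proof (rule openin_continuous_map_preimage[where Y=euclideanreal])
    have "k \<in> Field \<tau>" using that assms by auto
    then show "continuous_map (cylinder \<tau>) euclideanreal (\<lambda>q. snd q k)"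
      using continuous_map_compose[OF continuous_map_snd continuous_map_cube_component]
      by (fastforce simp: cylinder_def o_def)
  qed auto
  ultimately have "openin (cylinder \<tau>) (\<Inter>(insert {q \<in> topspace (cylinder \<tau>). fst q \<in> ball (fst p) d}
      ((\<lambda>k. {q \<in> topspace (cylinder \<tau>). snd q k \<in> ball (snd p k) d}) ` S)))"
    using assms(1) by (intro openin_Inter) auto
  moreover have "\<Inter>(insert {q \<in> topspace (cylinder \<tau>). fst q \<in> ball (fst p) d}
      ((\<lambda>k. {q \<in> topspace (cylinder \<tau>). snd q k \<in> ball (snd p k) d}) ` S)) = small_box \<tau> S d p"
    by (auto simp: small_box_def dist_real_def abs_minus_commute)
  ultimately show ?thesis by simp
qed

lemma openin_cylinder_contains_box:
  assumes "openin (cylinder \<tau>) W" "p \<in> W"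
  shows "\<exists>S d. finite S \<and> S \<subseteq> Field \<tau> \<and> d > 0 \<and> small_box \<tau> S d p \<subseteq> W"
proof -
  obtain t a where p: "p = (t,a)" by (cases p)
  obtain U V where UV: "openin (top_of_set {0..1}) U" "openin (cube \<tau>) V" "t \<in> U" "a \<in> V" "U \<times> V \<subseteq> W"
    using assms(1)[unfolded cylinder_def openin_prod_topology_alt, rule_format, OF assms(2)[unfolded p]]
    by (elim exE conjE)
  obtain e where e: "e > 0" "\<And>r. r \<in> {0..1} \<Longrightarrow> \<bar>r - t\<bar> < e \<Longrightarrow> r \<in> U"
    using UV(1,3) unfolding openin_euclidean_subtopology_iff by (auto simp: dist_real_def)
  obtain S d where S: "finite S" "S \<subseteq> Field \<tau>" "d > 0"
    "\<And>x. x \<in> topspace (cube \<tau>) \<Longrightarrow> (\<And>k. k \<in> S \<Longrightarrow> \<bar>x k - a k\<bar> < d) \<Longrightarrow> x \<in> V"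
    using openin_cube_contains_box[OF UV(2,4)] by metis
  have "small_box \<tau> S (min e d) p \<subseteq> U \<times> V"
    using e S(4) by (auto simp: small_box_def p topspace_cylinder)
  then show ?thesis
    using S e UV(5) by (intro exI[of _ S] exI[of _ "min e d"]) auto
qed

text \<open>The two properties of the complement of a $Z_\tau$-set that the extension theorem needs: it is open, and every
  countable subproduct of the cube is covered by its projection.\<close>

definition thick :: "'k rel \<Rightarrow> ('k \<Rightarrow> real) set \<Rightarrow> bool" where
  "thick \<tau> M \<longleftrightarrow> openin (cube \<tau>) M \<and>
     (\<forall>J a. J \<subseteq> Field \<tau> \<longrightarrow> countable J \<longrightarrow> a \<in> topspace (cube \<tau>) \<longrightarrow> (\<exists>b\<in>M. \<forall>k\<in>J. b k = a k))"

lemma thick_Z_set_compl: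
  assumes tau: "Card_order \<tau>" "natLeq <o \<tau>" and X: "Z_set \<tau> (cube \<tau>) X"
  shows "thick \<tau> (cube_compl \<tau> X)"
  unfolding thick_def
proof (intro conjI allI impI)
  show "openin (cube \<tau>) (cube_compl \<tau> X)"
    using X by (simp add: cube_compl_def Z_set_closedin openin_diff)
next
  fix J a assume J: "J \<subseteq> Field \<tau>" "countable J" and a: "a \<in> topspace (cube \<tau>)"
  from countable_ordLess[OF tau(2) J(2)]
  obtain s where s: "continuous_map (cube \<tau>) (cube \<tau>) s"
    "\<forall>x\<in>topspace (cube \<tau>). (\<forall>k\<in>J. s x k = x k) \<and> s x \<notin> X"
    using Z_set_avoiding_map[OF tau X J(1)] by blast
  then have "s a \<in> cube_compl \<tau> X" using a by (auto simp: cube_compl_def continuous_map_def)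
  then show "\<exists>b\<in>cube_compl \<tau> X. \<forall>k\<in>J. b k = a k" using s(2) a by blast
qed

lemma thick_subset: "thick \<tau> M \<Longrightarrow> M \<subseteq> topspace (cube \<tau>)"
  unfolding thick_def by (auto dest: openin_subset)

lemma thick_dense:
  assumes "thick \<tau> M"
  shows "cube \<tau> closure_of M = topspace (cube \<tau>)"
proof -
  have "\<exists>b\<in>M. b \<in> W" if W: "openin (cube \<tau>) W" "a \<in> W" for a W
  proof -
    obtain S e where S: "finite S" "S \<subseteq> Field \<tau>" "e > 0"
      "\<And>x. x \<in> topspace (cube \<tau>) \<Longrightarrow> (\<And>k. k \<in> S \<Longrightarrow> \<bar>x k - a k\<bar> < e) \<Longrightarrow> x \<in> W"
      using openin_cube_contains_box[OF W] by metis
    have "a \<in> topspace (cube \<tau>)" using W openin_subset by blast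
    then obtain b where "b \<in> M" "\<forall>k\<in>S. b k = a k"
      using assms S(1,2) countable_finite unfolding thick_def by blast
    then show ?thesis using S(3) S(4)[of b] thick_subset[OF assms] by auto
  qed
  then show ?thesis unfolding closure_of_def by blast
qed

lemma thick_cylinder_dense:
  "thick \<tau> M \<Longrightarrow> cylinder \<tau> closure_of ({0..1} \<times> M) = topspace (cylinder \<tau>)"
  using closure_of_topspace[of "top_of_set {0..1::real}"]
  by (simp add: cylinder_def closure_of_Times thick_dense)

lemma openin_thick_cylinder:
  "thick \<tau> M \<Longrightarrow> openin (cylinder \<tau>) ({0..1} \<times> M)"
  by (simp add: cylinder_def openin_prod_Times_iff thick_def)

text \<open>If the oscillation at \<open>p0\<close> were at least \<open>e\<close>, there would be points \<open>p n\<close> and \<open>q n\<close> of \<open>[0,1] \<times> M\<close> whose values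
  differ by at least \<open>e\<close> and which approach \<open>p0\<close> in the coordinates \<open>Q n\<close>. By continuity the values change little under
  modifications outside a finite set \<open>R n\<close>, and the construction puts \<open>R n\<close> into \<open>Q (n+1)\<close>. Let \<open>b\<close> be a
  point of \<open>M\<close> that agrees with \<open>p0\<close> on the countable set of all these coordinates. Replacing the coordinates of
  \<open>p n\<close> and \<open>q n\<close> outside \<open>R n\<close> by those of \<open>b\<close> gives two sequences that converge to the same point of
  \<open>[0,1] \<times> M\<close>, and continuity there contradicts the gap \<open>e\<close>.\<close>

lemma small_oscillation:
  assumes M: "thick \<tau> M"
    and h: "continuous_map (subtopology (cylinder \<tau>) ({0..1} \<times> M)) euclideanreal h"
    and p0: "p0 \<in> topspace (cylinder \<tau>)" and e: "e > 0"
  shows "\<exists>S d. finite S \<and> S \<subseteq> Field \<tau> \<and> d > 0 \<and>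
    (\<forall>p\<in>small_box \<tau> S d p0 \<inter> ({0..1} \<times> M). \<forall>q\<in>small_box \<tau> S d p0 \<inter> ({0..1} \<times> M). \<bar>h p - h q\<bar> < e)"
proof (rule ccontr)
  assume neg: "\<not> ?thesis"
  let ?M = "{0..1::real} \<times> M"
  have Msub: "?M \<subseteq> topspace (cylinder \<tau>)" using thick_subset[OF M] by (auto simp: topspace_cylinder)
  have local: "\<exists>S d. finite S \<and> S \<subseteq> Field \<tau> \<and> d > 0 \<and> (\<forall>q\<in>small_box \<tau> S d p. q \<in> ?M \<and> \<bar>h q - h p\<bar> < e/4)"
    if p: "p \<in> ?M" for p
  proof -
    let ?W = "{q \<in> topspace (subtopology (cylinder \<tau>) ?M). h q \<in> ball (h p) (e/4)}"
    have "openin (subtopology (cylinder \<tau>) ?M) ?W"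
      by (rule openin_continuous_map_preimage[OF h]) auto
    then have "openin (cylinder \<tau>) ?W"
      using openin_trans_full openin_thick_cylinder[OF M] by blast
    moreover have "p \<in> ?W" using p Msub e by auto
    ultimately obtain S d where "finite S" "S \<subseteq> Field \<tau>" "d > 0" "small_box \<tau> S d p \<subseteq> ?W"
      using openin_cylinder_contains_box[of \<tau> ?W p] by blast
    then show ?thesis
      by (intro exI[of _ S] exI[of _ d]) (auto simp: dist_real_def abs_minus_commute)
  qed
  \<comment> \<open>The same in terms of exact agreement on a finite set of coordinates, which survives arbitrary
    changes elsewhere.\<close>
  have local': "\<exists>R. finite R \<and> R \<subseteq> Field \<tau> \<and>
      (\<forall>x\<in>topspace (cube \<tau>). (\<forall>k\<in>R. x k = snd p k) \<longrightarrow> (fst p, x) \<in> ?M \<and> \<bar>h (fst p, x) - h p\<bar> < e/4)"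
    if p: "p \<in> ?M" for p
  proof -
    obtain S d where S: "finite S" "S \<subseteq> Field \<tau>" "d > 0"
      "\<forall>q\<in>small_box \<tau> S d p. q \<in> ?M \<and> \<bar>h q - h p\<bar> < e/4"
      using local[OF p] by blast
    have "(fst p, x) \<in> small_box \<tau> S d p" if "x \<in> topspace (cube \<tau>)" "\<forall>k\<in>S. x k = snd p k" for x
      using that p S(3) by (auto simp: small_box_def topspace_cylinder)
    then show ?thesis using S by (intro exI[of _ S]) blast
  qed
  define bad where "bad S n p q R \<longleftrightarrow> p \<in> ?M \<and> q \<in> ?M \<and> p \<in> small_box \<tau> S (1 / Suc n) p0 \<and>
      q \<in> small_box \<tau> S (1 / Suc n) p0 \<and> e \<le> \<bar>h p - h q\<bar> \<and> finite R \<and> R \<subseteq> Field \<tau> \<and>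
      (\<forall>x\<in>topspace (cube \<tau>). (\<forall>k\<in>R. x k = snd p k) \<longrightarrow> (fst p, x) \<in> ?M \<and> \<bar>h (fst p, x) - h p\<bar> < e/4) \<and>
      (\<forall>x\<in>topspace (cube \<tau>). (\<forall>k\<in>R. x k = snd q k) \<longrightarrow> (fst q, x) \<in> ?M \<and> \<bar>h (fst q, x) - h q\<bar> < e/4)"
    for S and n :: nat and p q R
  have "\<exists>z. finite S \<and> S \<subseteq> Field \<tau> \<longrightarrow> bad S n (fst z) (fst (snd z)) (snd (snd z))" for S n
  proof (cases "finite S \<and> S \<subseteq> Field \<tau>")
    case True
    have "\<exists>p\<in>small_box \<tau> S (1 / Suc n) p0 \<inter> ?M. \<exists>q\<in>small_box \<tau> S (1 / Suc n) p0 \<inter> ?M. \<not> \<bar>h p - h q\<bar> < e"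
      using neg[unfolded not_ex, rule_format, of S "1 / Suc n"] True by simp
    then obtain p q where pq: "p \<in> ?M" "q \<in> ?M" "p \<in> small_box \<tau> S (1 / Suc n) p0"
      "q \<in> small_box \<tau> S (1 / Suc n) p0" "e \<le> \<bar>h p - h q\<bar>"
      by auto
    obtain R1 where R1: "finite R1" "R1 \<subseteq> Field \<tau>"
      "\<forall>x\<in>topspace (cube \<tau>). (\<forall>k\<in>R1. x k = snd p k) \<longrightarrow> (fst p, x) \<in> ?M \<and> \<bar>h (fst p, x) - h p\<bar> < e/4"
      using local'[OF pq(1)] by blast
    obtain R2 where R2: "finite R2" "R2 \<subseteq> Field \<tau>"
      "\<forall>x\<in>topspace (cube \<tau>). (\<forall>k\<in>R2. x k = snd q k) \<longrightarrow> (fst q, x) \<in> ?M \<and> \<bar>h (fst q, x) - h q\<bar> < e/4"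
      using local'[OF pq(2)] by blast
    have "bad S n p q (R1 \<union> R2)"
      unfolding bad_def using pq R1 R2 by (intro conjI) (assumption | simp)+
    then show ?thesis by (intro exI[of _ "(p, q, R1 \<union> R2)"]) simp
  next
    case False
    then show ?thesis by blast
  qed
  then obtain Z where Z: "\<And>S n. finite S \<and> S \<subseteq> Field \<tau> \<Longrightarrow>
      bad S n (fst (Z S n)) (fst (snd (Z S n))) (snd (snd (Z S n)))"
    by metis
  define Q where "Q = rec_nat {} (\<lambda>n S. S \<union> snd (snd (Z S n)))"
  have Q_Suc: "Q (Suc n) = Q n \<union> snd (snd (Z (Q n) n))" for n by (simp add: Q_def)
  have Q: "finite (Q n) \<and> Q n \<subseteq> Field \<tau>" for n
  proof (induction n)
    case 0 show ?case by (simp add: Q_def)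
  next
    case (Suc n)
    then show ?case using Z[OF Suc, of n] unfolding Q_Suc bad_def by simp
  qed
  define p where "p n = fst (Z (Q n) n)" for n
  define q where "q n = fst (snd (Z (Q n) n))" for n
  define R where "R n = snd (snd (Z (Q n) n))" for n
  have bad: "bad (Q n) n (p n) (q n) (R n)" for n
    using Z[OF Q] by (simp add: p_def q_def R_def)
  have Q_mono: "Q m \<subseteq> Q n" if "m \<le> n" for m n
    using lift_Suc_mono_le[of Q, OF _ that] by (auto simp: Q_Suc)
  have R_sub: "R n \<subseteq> (\<Union>n. Q n)" for n
    using Q_Suc[of n] by (auto simp: R_def)
  have "countable (\<Union>n. Q n)" using Q by (intro countable_UN) (auto simp: countable_finite)
  moreover have "(\<Union>n. Q n) \<subseteq> Field \<tau>" using Q by blast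
  moreover have "snd p0 \<in> topspace (cube \<tau>)" using p0 by (auto simp: topspace_cylinder)
  ultimately obtain b where b: "b \<in> M" "\<forall>k\<in>(\<Union>n. Q n). b k = snd p0 k"
    using M unfolding thick_def by blast
  have bc: "b \<in> topspace (cube \<tau>)" using b thick_subset[OF M] by blast
  have b0: "(fst p0, b) \<in> ?M" using p0 b by (auto simp: topspace_cylinder)
  obtain S d where S: "finite S" "S \<subseteq> Field \<tau>" "d > 0"
    "\<forall>q\<in>small_box \<tau> S d (fst p0, b). q \<in> ?M \<and> \<bar>h q - h (fst p0, b)\<bar> < e/4"
    using local[OF b0] by blast
  \<comment> \<open>A coordinate in the finite set \<open>S\<close> that ever occurs in some \<open>Q n\<close> occurs in \<open>Q m\<close>, hence is controlled from
    stage \<open>m\<close> on; the others are never in \<open>R n\<close>, so there the modified points equal \<open>b\<close>.\<close>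
  have "\<exists>m. S \<inter> (\<Union>n. Q n) \<subseteq> Q m"
  proof -
    have "\<exists>m. F \<subseteq> Q m" if "finite F" "F \<subseteq> (\<Union>n. Q n)" for F
      using that
    proof induction
      case (insert k F)
      then obtain m1 m2 where "F \<subseteq> Q m1" "k \<in> Q m2" by auto
      then show ?case using Q_mono[of m1 "max m1 m2"] Q_mono[of m2 "max m1 m2"]
        by (intro exI[of _ "max m1 m2"]) auto
    qed simp
    then show ?thesis using S(1) by simp
  qed
  then obtain m where m: "S \<inter> (\<Union>n. Q n) \<subseteq> Q m" by blast
  obtain n0 where n0: "1 / Suc n0 < d" using nat_approx_posE[OF S(3)] by auto
  define n where "n = max m n0"
  have nm: "S \<inter> (\<Union>n. Q n) \<subseteq> Q n" using m Q_mono[of m n] by (auto simp: n_def)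
  have "1 / Suc n \<le> 1 / Suc n0" by (simp add: n_def frac_le)
  then have nd: "1 / Suc n < d" using n0 by linarith
  have near: "\<bar>h r - h (fst p0, b)\<bar> < e/2"
    if r: "r \<in> small_box \<tau> (Q n) (1 / Suc n) p0"
      and R: "\<forall>x\<in>topspace (cube \<tau>). (\<forall>k\<in>R n. x k = snd r k) \<longrightarrow> (fst r, x) \<in> ?M \<and> \<bar>h (fst r, x) - h r\<bar> < e/4"
    for r
  proof -
    define y where "y = override_on b (snd r) (R n)"
    have y: "y \<in> topspace (cube \<tau>)"
      unfolding y_def using r bc by (intro override_on_mem_cube) (auto simp: small_box_def topspace_cylinder)
    have "\<bar>y k - b k\<bar> < d" if k: "k \<in> S" for k
    proof (cases "k \<in> R n")
      case True
      then have "k \<in> Q n" using nm R_sub k by blast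
      then have "\<bar>snd r k - snd p0 k\<bar> < 1 / Suc n" using r by (auto simp: small_box_def)
      moreover have "b k = snd p0 k" using b(2) \<open>k \<in> Q n\<close> by blast
      ultimately show ?thesis using True nd by (simp add: y_def)
    qed (use S(3) in \<open>simp add: y_def\<close>)
    moreover have "\<bar>fst r - fst p0\<bar> < d" "fst r \<in> {0..1}"
      using r nd by (auto simp: small_box_def topspace_cylinder)
    ultimately have "(fst r, y) \<in> small_box \<tau> S d (fst p0, b)"
      using y by (auto simp: small_box_def topspace_cylinder)
    then have "\<bar>h (fst r, y) - h (fst p0, b)\<bar> < e/4" using S(4) by blast
    moreover have "\<bar>h (fst r, y) - h r\<bar> < e/4" using R y by (simp add: y_def)
    ultimately show ?thesis by linarith
  qed
  have "\<bar>h (p n) - h (fst p0, b)\<bar> < e/2" "\<bar>h (q n) - h (fst p0, b)\<bar> < e/2"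
    using near[of "p n"] near[of "q n"] bad[of n] unfolding bad_def by blast+
  moreover have "e \<le> \<bar>h (p n) - h (q n)\<bar>" using bad[of n] by (simp add: bad_def)
  ultimately show False by linarith
qed

text \<open>The oscillation conditions at a point \<open>p0\<close> for \<open>e = 1/(n+1)\<close> involve countably many coordinates, and
  a point \<open>b\<close> of \<open>M\<close> that agrees with \<open>p0\<close> there lies in all the corresponding boxes. So the value at \<open>b\<close> is
  the limit at \<open>p0\<close>.\<close>

lemma extend_real_from_thick_cylinder:
  assumes M: "thick \<tau> M"
    and h: "continuous_map (subtopology (cylinder \<tau>) ({0..1} \<times> M)) euclideanreal h"
  shows "\<exists>g. continuous_map (cylinder \<tau>) euclideanreal g \<and> (\<forall>p\<in>{0..1} \<times> M. g p = h p)"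
proof -
  let ?M = "{0..1::real} \<times> M"
  have Msub: "?M \<subseteq> topspace (cylinder \<tau>)" using thick_subset[OF M] by (auto simp: topspace_cylinder)
  have lim: "\<exists>l. limitin euclideanreal h l (atin_within (cylinder \<tau>) p0 ?M)"
    if p0: "p0 \<in> topspace (cylinder \<tau>)" for p0
  proof -
    have "\<exists>S d. finite S \<and> S \<subseteq> Field \<tau> \<and> d > 0 \<and>
      (\<forall>p\<in>small_box \<tau> S d p0 \<inter> ?M. \<forall>q\<in>small_box \<tau> S d p0 \<inter> ?M. \<bar>h p - h q\<bar> < 1 / Suc n)" for n
      by (rule small_oscillation[OF M h p0]) simp
    then obtain S d where Sd: "\<And>n. finite (S n) \<and> S n \<subseteq> Field \<tau> \<and> d n > 0 \<and>
      (\<forall>p\<in>small_box \<tau> (S n) (d n) p0 \<inter> ?M. \<forall>q\<in>small_box \<tau> (S n) (d n) p0 \<inter> ?M. \<bar>h p - h q\<bar> < 1 / Suc n)"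
      by metis
    have "countable (\<Union>n. S n)" using Sd by (intro countable_UN) (auto simp: countable_finite)
    moreover have "(\<Union>n. S n) \<subseteq> Field \<tau>" using Sd by blast
    moreover have "snd p0 \<in> topspace (cube \<tau>)" using p0 by (auto simp: topspace_cylinder)
    ultimately obtain b where b: "b \<in> M" "\<forall>k\<in>(\<Union>n. S n). b k = snd p0 k"
      using M unfolding thick_def by blast
    have b0: "(fst p0, b) \<in> ?M" using p0 b by (auto simp: topspace_cylinder)
    have bbox: "(fst p0, b) \<in> small_box \<tau> (S n) (d n) p0" for n
      using b b0 Msub Sd[of n] by (auto simp: small_box_def)
    have "(h \<longlongrightarrow> h (fst p0, b)) (atin_within (cylinder \<tau>) p0 ?M)"
      unfolding tendsto_iff
    proof (intro allI impI)
      fix e :: real assume "0 < e"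
      then obtain n where n: "1 / Suc n < e" using nat_approx_posE by metis
      have "\<forall>x\<in>small_box \<tau> (S n) (d n) p0. x \<in> ?M \<and> x \<noteq> p0 \<longrightarrow> dist (h x) (h (fst p0, b)) < e"
      proof (intro ballI impI)
        fix x assume x: "x \<in> small_box \<tau> (S n) (d n) p0" "x \<in> ?M \<and> x \<noteq> p0"
        then have "\<bar>h x - h (fst p0, b)\<bar> < 1 / Suc n"
          using Sd[of n] bbox[of n] b0 by blast
        then show "dist (h x) (h (fst p0, b)) < e" using n by (simp add: dist_real_def)
      qed
      moreover have "openin (cylinder \<tau>) (small_box \<tau> (S n) (d n) p0)"
        using Sd by (intro openin_small_box) auto
      moreover have "p0 \<in> small_box \<tau> (S n) (d n) p0" using p0 Sd by (auto simp: small_box_def)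
      ultimately show "\<forall>\<^sub>F x in atin_within (cylinder \<tau>) p0 ?M. dist (h x) (h (fst p0, b)) < e"
        unfolding eventually_atin_within by blast
    qed
    then show ?thesis by auto
  qed
  obtain g where "continuous_map (subtopology (cylinder \<tau>) (topspace (cylinder \<tau>))) euclideanreal g"
    "\<And>x. x \<in> ?M \<Longrightarrow> g x = h x"
  proof (rule continuous_map_extension_pointwise_alt[OF _ Msub _ h])
    show "topspace (cylinder \<tau>) \<subseteq> cylinder \<tau> closure_of ?M"
      using thick_cylinder_dense[OF M] by simp
  qed (use lim in \<open>auto simp: regular_space_euclidean\<close>)
  then show ?thesis by (auto simp: subtopology_topspace)
qed

text \<open>Coordinatewise extension, truncated to the unit interval.\<close>

lemma extend_from_thick_cylinder:
  assumes M: "thick \<tau> M"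
    and h: "continuous_map (subtopology (cylinder \<tau>) ({0..1} \<times> M)) (cube \<tau>) h"
  shows "\<exists>E. continuous_map (cylinder \<tau>) (cube \<tau>) E \<and> (\<forall>p\<in>{0..1} \<times> M. E p = h p)"
proof -
  let ?M = "{0..1::real} \<times> M"
  have Msub: "?M \<subseteq> topspace (cylinder \<tau>)" using thick_subset[OF M] by (auto simp: topspace_cylinder)
  have hmem: "h p \<in> topspace (cube \<tau>)" if "p \<in> ?M" for p
    using h that Msub by (auto simp: continuous_map_cube_iff)
  have "\<exists>g. continuous_map (cylinder \<tau>) euclideanreal g \<and> (\<forall>p\<in>?M. g p = h p k)" if "k \<in> Field \<tau>" for k
    by (rule extend_real_from_thick_cylinder[OF M]) (use h that in \<open>auto simp: continuous_map_cube_iff\<close>)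
  then obtain g where g: "\<forall>k\<in>Field \<tau>. continuous_map (cylinder \<tau>) euclideanreal (g k) \<and> (\<forall>p\<in>?M. g k p = h p k)"
    by metis
  define E where "E p = (\<lambda>k\<in>Field \<tau>. max 0 (min 1 (g k p)))" for p
  have "continuous_map (cylinder \<tau>) (cube \<tau>) E"
    unfolding continuous_map_cube_iff
  proof (intro conjI ballI)
    show "E \<in> topspace (cylinder \<tau>) \<rightarrow> topspace (cube \<tau>)"
      by (auto simp: E_def topspace_cube)
    fix k assume k: "k \<in> Field \<tau>"
    then have "continuous_map (cylinder \<tau>) euclideanreal (g k)" using g by blast
    then have "continuous_map (cylinder \<tau>) euclideanreal (\<lambda>p. max 0 (min 1 (g k p)))"
      by (rule continuous_map_real_max[OF continuous_map_canonical_const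
            continuous_map_real_min[OF continuous_map_canonical_const]])
    then show "continuous_map (cylinder \<tau>) euclideanreal (\<lambda>p. E p k)" using k by (simp add: E_def)
  qed
  moreover have "E p = h p" if p: "p \<in> ?M" for p
  proof (rule cube_eqI[OF _ hmem[OF p]])
    show "E p \<in> topspace (cube \<tau>)" by (auto simp: E_def topspace_cube)
    show "E p k = h p k" if "k \<in> Field \<tau>" for k
    proof -
      have "g k p = h p k" using g that p by blast
      then show ?thesis using that cube_component_bounds[OF hmem[OF p] that] by (simp add: E_def)
    qed
  qed
  ultimately show ?thesis by blast
qed

section \<open>Isomorphisms of categories and the homotopy category\<close>

text \<open>The category laws of \<open>C\<close> follow from those of \<open>D\<close>: both sides of a law have the same image, and \<open>F1\<close> is
  injective on hom-sets. The inverse functor consists of the inverse bijections.\<close>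

lemma is_category_isomorphismI:
  assumes D: "is_category D"
    and F0: "bij_betw F0 (Obj C) (Obj D)"
    and F1: "\<And>X Y. X \<in> Obj C \<Longrightarrow> Y \<in> Obj C \<Longrightarrow> bij_betw (F1 X Y) (Hom C X Y) (Hom D (F0 X) (F0 Y))"
    and id: "\<And>X. X \<in> Obj C \<Longrightarrow> Ident C X \<in> Hom C X X \<and> F1 X X (Ident C X) = Ident D (F0 X)"
    and comp: "\<And>X Y Z f g. X \<in> Obj C \<Longrightarrow> Y \<in> Obj C \<Longrightarrow> Z \<in> Obj C \<Longrightarrow> f \<in> Hom C X Y \<Longrightarrow>
        g \<in> Hom C Y Z \<Longrightarrow> Comp C X Y Z g f \<in> Hom C X Z \<and>
        F1 X Z (Comp C X Y Z g f) = Comp D (F0 X) (F0 Y) (F0 Z) (F1 Y Z g) (F1 X Y f)"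
  shows "is_category_isomorphism C D F0 F1"
proof -
  have F0_mem: "F0 X \<in> Obj D" if "X \<in> Obj C" for X
    using F0 that by (auto simp: bij_betw_def)
  have F1_mem: "F1 X Y f \<in> Hom D (F0 X) (F0 Y)" if "X \<in> Obj C" "Y \<in> Obj C" "f \<in> Hom C X Y" for X Y f
    using F1[OF that(1,2)] that(3) by (auto simp: bij_betw_def)
  have faithful: "f = g" if "X \<in> Obj C" "Y \<in> Obj C" "f \<in> Hom C X Y" "g \<in> Hom C X Y" "F1 X Y f = F1 X Y g"
    for X Y f g
    using F1[OF that(1,2)] that(3-5) by (auto simp: bij_betw_def inj_on_def)
  have idm: "Ident C X \<in> Hom C X X" and idF: "F1 X X (Ident C X) = Ident D (F0 X)" if "X \<in> Obj C" for X
    using id[OF that] by auto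
  have cm: "Comp C X Y Z g f \<in> Hom C X Z"
    and cF: "F1 X Z (Comp C X Y Z g f) = Comp D (F0 X) (F0 Y) (F0 Z) (F1 Y Z g) (F1 X Y f)"
    if "X \<in> Obj C" "Y \<in> Obj C" "Z \<in> Obj C" "f \<in> Hom C X Y" "g \<in> Hom C Y Z" for X Y Z f g
    using comp[OF that] by auto
  have D_unit: "Comp D X X Y f (Ident D X) = f" "Comp D X Y Y (Ident D Y) f = f"
    if "X \<in> Obj D" "Y \<in> Obj D" "f \<in> Hom D X Y" for X Y f
    using D that unfolding is_category_def by blast+
  have D_assoc: "Comp D W X Z (Comp D X Y Z h g) f = Comp D W Y Z h (Comp D W X Y g f)"
    if "W \<in> Obj D" "X \<in> Obj D" "Y \<in> Obj D" "Z \<in> Obj D" "f \<in> Hom D W X" "g \<in> Hom D X Y" "h \<in> Hom D Y Z"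
    for W X Y Z f g h
    using D that unfolding is_category_def by blast
  have C: "is_category C"
    unfolding is_category_def
  proof (intro conjI ballI)
    fix X Y f assume X: "X \<in> Obj C" and Y: "Y \<in> Obj C" and f: "f \<in> Hom C X Y"
    show "Comp C X X Y f (Ident C X) = f"
      by (rule faithful[OF X Y cm[OF X X Y idm[OF X] f] f])
        (simp add: cF[OF X X Y idm[OF X] f] idF[OF X] D_unit F0_mem F1_mem X Y f)
    show "Comp C X Y Y (Ident C Y) f = f"
      by (rule faithful[OF X Y cm[OF X Y Y f idm[OF Y]] f])
        (simp add: cF[OF X Y Y f idm[OF Y]] idF[OF Y] D_unit F0_mem F1_mem X Y f)
  next
    fix W X Y Z f g h
    assume W: "W \<in> Obj C" and X: "X \<in> Obj C" and Y: "Y \<in> Obj C" and Z: "Z \<in> Obj C"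
      and f: "f \<in> Hom C W X" and g: "g \<in> Hom C X Y" and h: "h \<in> Hom C Y Z"
    note hg = cm[OF X Y Z g h] and gf = cm[OF W X Y f g]
    show "Comp C W X Z (Comp C X Y Z h g) f = Comp C W Y Z h (Comp C W X Y g f)"
      by (rule faithful[OF W Z cm[OF W X Z f hg] cm[OF W Y Z gf h]])
        (simp add: cF[OF W X Z f hg] cF[OF W Y Z gf h] cF[OF X Y Z g h] cF[OF W X Y f g]
          D_assoc F0_mem F1_mem W X Y Z f g h)
  qed (use idm cm in auto)
  have F: "is_functor C D F0 F1"
    unfolding is_functor_def using C D F0_mem F1_mem idF cF by simp
  define G0 where "G0 = inv_into (Obj C) F0"
  define G1 where "G1 X Y = inv_into (Hom C (G0 X) (G0 Y)) (F1 (G0 X) (G0 Y))" for X Y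
  have F0G0: "F0 (G0 X) = X" and G0_mem: "G0 X \<in> Obj C" if "X \<in> Obj D" for X
    using that F0 unfolding G0_def bij_betw_def by (auto simp: f_inv_into_f inv_into_into)
  have G0F0: "G0 (F0 X) = X" if "X \<in> Obj C" for X
    using that F0 unfolding G0_def bij_betw_def by auto
  have G1_mem: "G1 X Y f \<in> Hom C (G0 X) (G0 Y)" and F1G1: "F1 (G0 X) (G0 Y) (G1 X Y f) = f"
    if "X \<in> Obj D" "Y \<in> Obj D" "f \<in> Hom D X Y" for X Y f
  proof -
    have "f \<in> F1 (G0 X) (G0 Y) ` Hom C (G0 X) (G0 Y)"
      using F1[OF G0_mem G0_mem] that F0G0 by (simp add: bij_betw_def)
    then show "G1 X Y f \<in> Hom C (G0 X) (G0 Y)" "F1 (G0 X) (G0 Y) (G1 X Y f) = f"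
      unfolding G1_def by (rule inv_into_into, rule f_inv_into_f)
  qed
  have G1F1: "G1 (F0 X) (F0 Y) (F1 X Y f) = f" if "X \<in> Obj C" "Y \<in> Obj C" "f \<in> Hom C X Y" for X Y f
    using F1[OF that(1,2)] that by (simp add: G1_def G0F0 bij_betw_def)
  have "is_functor D C G0 G1"
    unfolding is_functor_def
  proof (intro conjI ballI)
    fix X assume X: "X \<in> Obj D"
    show "G1 X X (Ident D X) = Ident C (G0 X)"
      using G1F1[OF G0_mem[OF X] G0_mem[OF X] idm[OF G0_mem[OF X]]] idF[OF G0_mem[OF X]] F0G0[OF X]
      by simp
  next
    fix X Y Z f g
    assume X: "X \<in> Obj D" and Y: "Y \<in> Obj D" and Z: "Z \<in> Obj D"
      and f: "f \<in> Hom D X Y" and g: "g \<in> Hom D Y Z"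
    note GX = G0_mem[OF X] and GY = G0_mem[OF Y] and GZ = G0_mem[OF Z]
      and Gf = G1_mem[OF X Y f] and Gg = G1_mem[OF Y Z g]
    show "G1 X Z (Comp D X Y Z g f) = Comp C (G0 X) (G0 Y) (G0 Z) (G1 Y Z g) (G1 X Y f)"
      using G1F1[OF GX GZ cm[OF GX GY GZ Gf Gg]]
      by (simp add: cF[OF GX GY GZ Gf Gg] F0G0 F1G1 X Y Z f g)
  qed (use C D G0_mem G1_mem in auto)
  then show ?thesis
    unfolding is_category_isomorphism_def using F G0F0 G1F1 F0G0 F1G1 by blast
qed

lemma homotopy_class_eq_iff:
  assumes "continuous_map A B f"
  shows "homotopy_class A B f = homotopy_class A B g \<longleftrightarrow> homotopic_with (\<lambda>_. True) A B f g"
proof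
  assume "homotopy_class A B f = homotopy_class A B g"
  moreover have "f \<in> homotopy_class A B f" using assms by (simp add: homotopy_class_def)
  ultimately show "homotopic_with (\<lambda>_. True) A B f g"
    by (simp add: homotopy_class_def homotopic_with_sym)
next
  assume "homotopic_with (\<lambda>_. True) A B f g"
  then show "homotopy_class A B f = homotopy_class A B g"
    unfolding homotopy_class_def by (auto intro: homotopic_with_trans homotopic_with_symD)
qed

lemma homotopy_class_comp:
  assumes "continuous_map A B f" "continuous_map B C g"
  shows "(\<Union>f'\<in>homotopy_class A B f. \<Union>g'\<in>homotopy_class B C g. homotopy_class A C (g' \<circ> f'))
    = homotopy_class A C (g \<circ> f)"
proof -
  have "homotopy_class A C (g' \<circ> f') = homotopy_class A C (g \<circ> f)"
    if "f' \<in> homotopy_class A B f" "g' \<in> homotopy_class B C g" for f' g'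
  proof -
    have "homotopic_with (\<lambda>_. True) A C (g \<circ> f) (g' \<circ> f')"
      using that by (intro homotopic_compose) (auto simp: homotopy_class_def)
    from iffD2[OF homotopy_class_eq_iff[OF continuous_map_compose[OF assms]] this]
    show ?thesis by (rule sym)
  qed
  moreover have "f \<in> homotopy_class A B f" "g \<in> homotopy_class B C g"
    using assms by (simp_all add: homotopy_class_def)
  ultimately show ?thesis by blast
qed

lemma is_category_H_cat: "is_category (H_cat \<tau>)"
proof -
  let ?S = "subtopology (cube \<tau>)"
  have comp: "Comp (H_cat \<tau>) X Y Z (homotopy_class (?S Y) (?S Z) g) (homotopy_class (?S X) (?S Y) f)
      = homotopy_class (?S X) (?S Z) (g \<circ> f)"
    if "continuous_map (?S X) (?S Y) f" "continuous_map (?S Y) (?S Z) g" for X Y Z f g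
    using homotopy_class_comp[OF that] by (simp add: H_cat_def Let_def)
  have ident: "Ident (H_cat \<tau>) X = homotopy_class (?S X) (?S X) id" for X
    by (simp add: H_cat_def Let_def)
  have hom: "c \<in> Hom (H_cat \<tau>) X Y \<longleftrightarrow> (\<exists>f. c = homotopy_class (?S X) (?S Y) f \<and> continuous_map (?S X) (?S Y) f)"
    for c X Y by (auto simp: H_cat_def Let_def)
  show ?thesis
    unfolding is_category_def
  proof (intro conjI ballI)
    fix X show "Ident (H_cat \<tau>) X \<in> Hom (H_cat \<tau>) X X"
      unfolding hom ident by (intro exI[of _ id]) (simp add: id_def)
  next
    fix X Y Z f g assume "f \<in> Hom (H_cat \<tau>) X Y" "g \<in> Hom (H_cat \<tau>) Y Z"
    then obtain f' g' where
      f: "f = homotopy_class (?S X) (?S Y) f'" "continuous_map (?S X) (?S Y) f'" and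
      g: "g = homotopy_class (?S Y) (?S Z) g'" "continuous_map (?S Y) (?S Z) g'"
      unfolding hom by blast
    show "Comp (H_cat \<tau>) X Y Z g f \<in> Hom (H_cat \<tau>) X Z"
      unfolding hom f(1) g(1) comp[OF f(2) g(2)]
      by (intro exI[of _ "g' \<circ> f'"] conjI refl continuous_map_compose[OF f(2) g(2)])
  next
    fix X Y f assume "f \<in> Hom (H_cat \<tau>) X Y"
    then obtain f' where f: "f = homotopy_class (?S X) (?S Y) f'" "continuous_map (?S X) (?S Y) f'"
      unfolding hom by blast
    show "Comp (H_cat \<tau>) X X Y f (Ident (H_cat \<tau>) X) = f"
      using comp[of X X id Y f'] f by (simp add: ident id_def[symmetric])
    show "Comp (H_cat \<tau>) X Y Y (Ident (H_cat \<tau>) Y) f = f"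
      using comp[of X Y f' Y id] f by (simp add: ident id_def[symmetric])
  next
    fix W X Y Z f g h
    assume "f \<in> Hom (H_cat \<tau>) W X" "g \<in> Hom (H_cat \<tau>) X Y" "h \<in> Hom (H_cat \<tau>) Y Z"
    then obtain f' g' h' where
      f: "f = homotopy_class (?S W) (?S X) f'" "continuous_map (?S W) (?S X) f'" and
      g: "g = homotopy_class (?S X) (?S Y) g'" "continuous_map (?S X) (?S Y) g'" and
      h: "h = homotopy_class (?S Y) (?S Z) h'" "continuous_map (?S Y) (?S Z) h'"
      unfolding hom by blast
    note hg = continuous_map_compose[OF g(2) h(2)] and gf = continuous_map_compose[OF f(2) g(2)]
    show "Comp (H_cat \<tau>) W X Z (Comp (H_cat \<tau>) X Y Z h g) f =
        Comp (H_cat \<tau>) W Y Z h (Comp (H_cat \<tau>) W X Y g f)"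
      unfolding f(1) g(1) h(1) comp[OF g(2) h(2)] comp[OF f(2) g(2)] comp[OF f(2) hg] comp[OF gf h(2)]
      by (simp add: comp_assoc)
  qed
qed

section \<open>Proper maps and proper homotopies in terms of their extensions\<close>

lemma proper_map_if_extension:
  assumes T: "compact_space T" and R: "Hausdorff_space R" and E: "continuous_map T R E"
    and DN: "\<And>x. x \<in> topspace T \<Longrightarrow> E x \<in> N \<longleftrightarrow> x \<in> D"
  shows "proper_continuous_map (subtopology T D) (subtopology R N) E"
  unfolding proper_continuous_map_def
proof (intro conjI allI impI)
  show "continuous_map (subtopology T D) (subtopology R N) E"
    using E DN by (auto simp: continuous_map_in_subtopology continuous_map_from_subtopology)
next
  fix K assume "compactin (subtopology R N) K"
  then have K: "closedin R K" "K \<subseteq> N"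
    using compactin_imp_closedin[OF R] by (auto simp: compactin_subtopology)
  have "compactin T {x \<in> topspace T. E x \<in> K}"
    using closedin_compact_space[OF T] closedin_continuous_map_preimage[OF E K(1)] by blast
  moreover have "{x \<in> topspace (subtopology T D). E x \<in> K} = {x \<in> topspace T. E x \<in> K}"
    using DN K(2) by auto
  moreover have "{x \<in> topspace T. E x \<in> K} \<subseteq> D"
    using DN K(2) by auto
  ultimately show "compactin (subtopology T D) {x \<in> topspace (subtopology T D). E x \<in> K}"
    by (simp add: compactin_subtopology)
qed

text \<open>If \<open>E x\<close> were in \<open>N\<close>, it would have a compact neighbourhood \<open>C\<close> in \<open>N\<close>. Its preimage under \<open>g\<close> is compact,
  hence closed, and does not contain \<open>x\<close>; but points of \<open>D\<close> close to \<open>x\<close> are mapped into \<open>C\<close>.\<close>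

lemma extension_of_proper_map_at_infinity:
  assumes T: "Hausdorff_space T" and R: "compact_space R" "Hausdorff_space R" and E: "continuous_map T R E"
    and D: "topspace T \<subseteq> T closure_of D" and N: "openin R N"
    and g: "proper_continuous_map (subtopology T D) (subtopology R N) g"
    and gE: "\<And>x. x \<in> D \<Longrightarrow> E x = g x"
    and x: "x \<in> topspace T" "x \<notin> D"
  shows "E x \<notin> N"
proof
  assume "E x \<in> N"
  have "neighbourhood_base_of (closedin R) R"
    using compact_Hausdorff_imp_regular_space[OF R] by (simp add: neighbourhood_base_of_closedin)
  then obtain V C where VC: "openin R V" "closedin R C" "E x \<in> V" "V \<subseteq> C" "C \<subseteq> N"
    using N \<open>E x \<in> N\<close> unfolding neighbourhood_base_of by meson
  have "compactin (subtopology R N) C"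
    using closedin_compact_space[OF R(1) VC(2)] VC(5) by (simp add: compactin_subtopology)
  then have "compactin T {x \<in> topspace (subtopology T D). g x \<in> C}"
    using g unfolding proper_continuous_map_def compactin_subtopology by blast
  then have "closedin T {x \<in> topspace (subtopology T D). g x \<in> C}"
    using compactin_imp_closedin[OF T] by blast
  then have "openin T ({y \<in> topspace T. E y \<in> V} - {x \<in> topspace (subtopology T D). g x \<in> C})" (is "openin T ?W")
    using openin_continuous_map_preimage[OF E VC(1)] by (intro openin_diff)
  then have W: "x \<in> ?W \<and> openin T ?W"
    using x VC(3) by auto
  have "x \<in> T closure_of D" using x D by blast
  then have "\<exists>y. y \<in> D \<and> y \<in> ?W"
    unfolding in_closure_of using W by (elim conjE allE impE) (rule conjI)
  then obtain d where "d \<in> D" "d \<in> ?W" by (elim exE conjE)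
  then show False using gE VC(4) by auto
qed

lemma homotopic_with_True_iff:
  "homotopic_with (\<lambda>_. True) X Y p q \<longleftrightarrow>
     (\<exists>h. continuous_map (prod_topology (top_of_set {0..1::real}) X) Y h \<and>
        (\<forall>x\<in>topspace X. h (0,x) = p x) \<and> (\<forall>x\<in>topspace X. h (1,x) = q x))"
  by (subst homotopic_with) simp_all

lemma compact_space_cylinder: "compact_space (cylinder \<tau>)"
  by (simp add: cylinder_def compact_space_prod_topology compact_space_cube compact_space_subtopology)

lemma Hausdorff_space_cylinder: "Hausdorff_space (cylinder \<tau>)"
  by (simp add: cylinder_def Hausdorff_space_prod_topology Hausdorff_space_cube Hausdorff_space_subtopology)

lemma normal_space_cube: "normal_space (cube \<tau>)"
  using compact_Hausdorff_or_regular_imp_normal_space compact_space_cube Hausdorff_space_cube by blast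

lemma normal_space_cylinder: "normal_space (cylinder \<tau>)"
  using compact_Hausdorff_or_regular_imp_normal_space compact_space_cylinder Hausdorff_space_cylinder by blast

lemma cylinder_subtopology:
  "prod_topology (top_of_set {0..1}) (subtopology (cube \<tau>) M) = subtopology (cylinder \<tau>) ({0..1} \<times> M)"
  by (simp add: cylinder_def prod_topology_subtopology(2))

lemma continuous_map_slice:
  assumes "continuous_map (cylinder \<tau>) Y E" "t \<in> {0..1}"
  shows "continuous_map (cube \<tau>) Y (\<lambda>x. E (t, x))"
  using continuous_map_o_Pair[OF assms(1)[unfolded cylinder_def], of t] assms(2) by (simp add: o_def)

text \<open>A map on \<open>M\<close> is a homotopy that is constant in time.\<close>

lemma extend_from_thick:
  assumes M: "thick \<tau> M" and g: "continuous_map (subtopology (cube \<tau>) M) (cube \<tau>) g"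
  shows "\<exists>F. continuous_map (cube \<tau>) (cube \<tau>) F \<and> (\<forall>x\<in>M. F x = g x)"
proof -
  have "continuous_map (subtopology (cylinder \<tau>) ({0..1} \<times> M)) (cube \<tau>) (g \<circ> snd)"
    unfolding cylinder_subtopology[symmetric]
    by (rule continuous_map_compose[OF continuous_map_snd g])
  then obtain E where E: "continuous_map (cylinder \<tau>) (cube \<tau>) E" "\<forall>p\<in>{0..1} \<times> M. E p = (g \<circ> snd) p"
    using extend_from_thick_cylinder[OF M] by blast
  show ?thesis
    by (rule exI[of _ "\<lambda>x. E (0, x)"]) (use continuous_map_slice[OF E(1), of 0] E(2) in auto)
qed

lemma cube_extension_unique:
  assumes M: "thick \<tau> M" and F: "continuous_map (cube \<tau>) (cube \<tau>) F" "\<And>x. x \<in> M \<Longrightarrow> F x = g x"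
  shows "cube_extension \<tau> M g = restrict F (topspace (cube \<tau>))"
  unfolding cube_extension_def
proof (rule the_equality)
  have "continuous_map (cube \<tau>) (cube \<tau>) (restrict F (topspace (cube \<tau>)))"
    by (rule continuous_map_eq[OF F(1)]) simp
  then show "restrict F (topspace (cube \<tau>)) \<in> continuous_maps (cube \<tau>) (cube \<tau>) \<and>
      (\<forall>x\<in>M. restrict F (topspace (cube \<tau>)) x = g x)"
    using F(2) thick_subset[OF M] by (auto simp: continuous_maps_def)
next
  fix h assume h: "h \<in> continuous_maps (cube \<tau>) (cube \<tau>) \<and> (\<forall>x\<in>M. h x = g x)"
  have "h x = F x" if "x \<in> topspace (cube \<tau>)" for x
    by (rule forall_in_closure_of_eq[of x "cube \<tau>" M "cube \<tau>"])
      (use h F that thick_dense[OF M] Hausdorff_space_cube in \<open>auto simp: continuous_maps_def\<close>)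
  then show "h = restrict F (topspace (cube \<tau>))"
    using h by (intro extensionalityI[of h "topspace (cube \<tau>)"]) (auto simp: continuous_maps_def)
qed

text \<open>The self-maps of the cube that correspond to the proper maps from the complement of \<open>X\<close> to the complement of
  \<open>Y\<close>: both \<open>X\<close> and its complement have to be respected.\<close>

definition pair_map :: "'k rel \<Rightarrow> ('k \<Rightarrow> real) set \<Rightarrow> ('k \<Rightarrow> real) set \<Rightarrow> (('k \<Rightarrow> real) \<Rightarrow> 'k \<Rightarrow> real) \<Rightarrow> bool" where
  "pair_map \<tau> X Y F \<longleftrightarrow> continuous_map (cube \<tau>) (cube \<tau>) F \<and>
     (\<forall>x\<in>topspace (cube \<tau>). F x \<in> Y \<longleftrightarrow> x \<in> X)"

lemma pair_map_comp: "pair_map \<tau> X Y F \<Longrightarrow> pair_map \<tau> Y W G \<Longrightarrow> pair_map \<tau> X W (G \<circ> F)"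
proof -
  assume F: "pair_map \<tau> X Y F" and G: "pair_map \<tau> Y W G"
  then have "continuous_map (cube \<tau>) (cube \<tau>) (G \<circ> F)"
    unfolding pair_map_def by (intro continuous_map_compose) auto
  moreover have "F x \<in> topspace (cube \<tau>)" if "x \<in> topspace (cube \<tau>)" for x
    using F that by (auto simp: pair_map_def continuous_map_def)
  ultimately show ?thesis
    using F G by (simp add: pair_map_def)
qed

lemma pair_map_id: "pair_map \<tau> X X id"
  by (simp add: pair_map_def)

context
  fixes \<tau> :: "'k rel"
  assumes tau: "Card_order \<tau>" "natLeq <o \<tau>"
begin

abbreviation (input) Z :: "('k \<Rightarrow> real) set \<Rightarrow> bool" where
  "Z X \<equiv> Z_set \<tau> (cube \<tau>) X"

abbreviation (input) sub :: "('k \<Rightarrow> real) set \<Rightarrow> ('k \<Rightarrow> real) topology" where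
  "sub X \<equiv> subtopology (cube \<tau>) X"

abbreviation (input) compl :: "('k \<Rightarrow> real) set \<Rightarrow> ('k \<Rightarrow> real) set" where
  "compl X \<equiv> cube_compl \<tau> X"

abbreviation (input) ext :: "('k \<Rightarrow> real) set \<Rightarrow> (('k \<Rightarrow> real) \<Rightarrow> 'k \<Rightarrow> real) \<Rightarrow> ('k \<Rightarrow> real) \<Rightarrow> 'k \<Rightarrow> real" where
  "ext X g \<equiv> cube_extension \<tau> (compl X) g"

abbreviation (input) proper :: "('k \<Rightarrow> real) set \<Rightarrow> ('k \<Rightarrow> real) set \<Rightarrow> (('k \<Rightarrow> real) \<Rightarrow> 'k \<Rightarrow> real) \<Rightarrow> bool" where
  "proper X Y g \<equiv> proper_continuous_map (sub (compl X)) (sub (compl Y)) g"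

lemma thick_compl: "Z X \<Longrightarrow> thick \<tau> (compl X)"
  by (rule thick_Z_set_compl[OF tau])

lemma mem_compl: "x \<in> compl X \<longleftrightarrow> x \<in> topspace (cube \<tau>) \<and> x \<notin> X"
  by (auto simp: cube_compl_def)

lemma topspace_sub: "Z X \<Longrightarrow> topspace (sub X) = X"
  using Z_set_subset by auto

lemma topspace_sub_compl: "topspace (sub (compl X)) = compl X"
  by (auto simp: cube_compl_def)

lemma pair_map_imp_proper: "pair_map \<tau> X Y F \<Longrightarrow> proper X Y F"
proof (rule proper_map_if_extension[OF compact_space_cube Hausdorff_space_cube])
  assume F: "pair_map \<tau> X Y F"
  then show "continuous_map (cube \<tau>) (cube \<tau>) F" by (simp add: pair_map_def)
  then have "F x \<in> topspace (cube \<tau>)" if "x \<in> topspace (cube \<tau>)" for x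
    using that by (auto simp: continuous_map_def)
  then show "F x \<in> compl Y \<longleftrightarrow> x \<in> compl X" if "x \<in> topspace (cube \<tau>)" for x
    using F that by (simp add: mem_compl pair_map_def)
qed

lemma pair_map_imp_continuous: "pair_map \<tau> X Y F \<Longrightarrow> continuous_map (sub X) (sub Y) F"
  unfolding pair_map_def by (auto simp: continuous_map_in_subtopology continuous_map_from_subtopology)

text \<open>The value of \<^const>\<open>cube_extension\<close> is computed from any continuous extension.\<close>

lemma ext_eq:
  assumes "Z X" "continuous_map (cube \<tau>) (cube \<tau>) F" "\<And>x. x \<in> compl X \<Longrightarrow> F x = g x" "x \<in> topspace (cube \<tau>)"
  shows "ext X g x = F x"
  using cube_extension_unique[OF thick_compl[OF assms(1)] assms(2,3)] assms(4) by simp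

lemma proper_cong:
  assumes "proper X Y f" "\<And>x. x \<in> compl X \<Longrightarrow> f x = g x"
  shows "proper X Y g"
proof -
  have "continuous_map (sub (compl X)) (sub (compl Y)) g"
    using assms unfolding proper_continuous_map_def by (auto intro: continuous_map_eq)
  moreover have "{x \<in> topspace (sub (compl X)). g x \<in> K} = {x \<in> topspace (sub (compl X)). f x \<in> K}" for K
    using assms(2) by auto
  ultimately show ?thesis using assms(1) unfolding proper_continuous_map_def by simp
qed

lemma ext_proper:
  assumes X: "Z X" and Y: "Z Y" and g: "proper X Y g"
  shows "pair_map \<tau> X Y (ext X g)" "\<And>x. x \<in> compl X \<Longrightarrow> ext X g x = g x"
proof -
  have gc: "continuous_map (sub (compl X)) (sub (compl Y)) g"
    using g by (simp add: proper_continuous_map_def)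
  obtain F where F: "continuous_map (cube \<tau>) (cube \<tau>) F" "\<forall>x\<in>compl X. F x = g x"
    using extend_from_thick[OF thick_compl[OF X], of g] gc by (auto simp: continuous_map_in_subtopology)
  have eq: "ext X g x = F x" if "x \<in> topspace (cube \<tau>)" for x
    by (rule ext_eq[OF X F(1)]) (use F(2) that in auto)
  then show "ext X g x = g x" if "x \<in> compl X" for x
    using that F(2) by (simp add: mem_compl)
  have "F x \<in> Y \<longleftrightarrow> x \<in> X" if x: "x \<in> topspace (cube \<tau>)" for x
  proof (cases "x \<in> X")
    case True
    have "F x \<notin> compl Y"
    proof (rule extension_of_proper_map_at_infinity[OF Hausdorff_space_cube compact_space_cube
          Hausdorff_space_cube F(1) _ _ g _ x])
      show "topspace (cube \<tau>) \<subseteq> cube \<tau> closure_of compl X"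
        using thick_dense[OF thick_compl[OF X]] by simp
      show "openin (cube \<tau>) (compl Y)" using thick_compl[OF Y] by (simp add: thick_def)
    qed (use F(2) True in \<open>auto simp: mem_compl\<close>)
    moreover have "F x \<in> topspace (cube \<tau>)" using F(1) x by (auto simp: continuous_map_def)
    ultimately show ?thesis using True by (simp add: mem_compl)
  next
    case False
    then have "x \<in> compl X" using x by (simp add: mem_compl)
    moreover from this have "g x \<in> compl Y"
      using gc unfolding continuous_map_def topspace_sub_compl by blast
    ultimately show ?thesis using F(2) False by (simp add: mem_compl)
  qed
  moreover have "continuous_map (cube \<tau>) (cube \<tau>) (ext X g)"
    by (rule continuous_map_eq[OF F(1)]) (simp add: eq)
  ultimately show "pair_map \<tau> X Y (ext X g)"
    by (simp add: pair_map_def eq)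
qed

text \<open>Fullness of \<open>\<mu>\<close> on the level of maps: a map defined on \<open>X\<close> extends without meeting \<open>Y\<close> off \<open>X\<close>.\<close>

lemma extend_to_pair_map:
  assumes X: "Z X" and Y: "Z Y" and f: "continuous_map (sub X) (sub Y) f"
  shows "\<exists>F. pair_map \<tau> X Y F \<and> (\<forall>x\<in>X. F x = f x)"
proof -
  have "\<exists>F. continuous_map (cube \<tau>) (cube \<tau>) F \<and> (\<forall>x\<in>X. F x = f x) \<and>
      (\<forall>x\<in>topspace (cube \<tau>) - X. F x \<notin> Y)"
  proof (rule Tietze_extension_avoiding_Z_set[OF tau Y normal_space_cube Z_set_closedin[OF X]
        closed_union_cube_compl[OF tau Z_set_closedin[OF X]]])
    show "continuous_map (sub X) (cube \<tau>) f"
      using f by (simp add: continuous_map_in_subtopology)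
  qed
  then obtain F where F: "continuous_map (cube \<tau>) (cube \<tau>) F" "\<forall>x\<in>X. F x = f x"
      "\<forall>x\<in>topspace (cube \<tau>) - X. F x \<notin> Y" by blast
  have "f x \<in> Y" if "x \<in> X" for x
    using f that topspace_sub[OF X] topspace_sub[OF Y] by (auto simp: continuous_map_def)
  then show ?thesis using F unfolding pair_map_def by (intro exI[of _ F]) auto
qed

lemma proper_homotopy_extension:
  assumes X: "Z X" and Y: "Z Y"
    and h: "proper_continuous_map (prod_topology (top_of_set {0..1}) (sub (compl X))) (sub (compl Y)) h"
  shows "\<exists>E. continuous_map (cylinder \<tau>) (cube \<tau>) E \<and> (\<forall>t\<in>{0..1}. pair_map \<tau> X Y (\<lambda>x. E (t, x))) \<and>
    (\<forall>t\<in>{0..1}. \<forall>x\<in>compl X. E (t, x) = h (t, x))"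
proof -
  let ?M = "{0..1::real} \<times> compl X"
  have h': "proper_continuous_map (subtopology (cylinder \<tau>) ?M) (sub (compl Y)) h"
    using h by (simp only: cylinder_subtopology)
  then have hc: "continuous_map (subtopology (cylinder \<tau>) ?M) (sub (compl Y)) h"
    by (simp add: proper_continuous_map_def)
  then obtain E where E: "continuous_map (cylinder \<tau>) (cube \<tau>) E" "\<forall>p\<in>?M. E p = h p"
    using extend_from_thick_cylinder[OF thick_compl[OF X], of h] by (auto simp: continuous_map_in_subtopology)
  have "E p \<in> Y \<longleftrightarrow> snd p \<in> X" if p: "p \<in> topspace (cylinder \<tau>)" for p
  proof (cases "snd p \<in> X")
    case True
    have "E p \<notin> compl Y"
    proof (rule extension_of_proper_map_at_infinity[OF Hausdorff_space_cylinder compact_space_cube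
          Hausdorff_space_cube E(1) _ _ h' _ p])
      show "topspace (cylinder \<tau>) \<subseteq> cylinder \<tau> closure_of ?M"
        using thick_cylinder_dense[OF thick_compl[OF X]] by simp
      show "openin (cube \<tau>) (compl Y)" using thick_compl[OF Y] by (simp add: thick_def)
      show "p \<notin> ?M" using True by (auto simp: mem_compl)
    qed (use E(2) in blast)
    moreover have "E p \<in> topspace (cube \<tau>)" using E(1) p by (auto simp: continuous_map_def)
    ultimately show ?thesis using True by (simp add: mem_compl)
  next
    case False
    then have pM: "p \<in> ?M" using p by (cases p) (auto simp: mem_compl topspace_cylinder)
    then have "p \<in> topspace (subtopology (cylinder \<tau>) ?M)" using p by simp
    then have "h p \<in> compl Y" using hc unfolding continuous_map_def topspace_sub_compl by blast
    then show ?thesis using E(2)[rule_format, OF pM] False by (simp add: mem_compl)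
  qed
  then have "pair_map \<tau> X Y (\<lambda>x. E (t, x))" if "t \<in> {0..1}" for t
    using that continuous_map_slice[OF E(1) that] by (simp add: pair_map_def topspace_cylinder)
  then show ?thesis using E by (intro exI[of _ E]) auto
qed

text \<open>The extension of a proper homotopy to the cylinder restricts over \<open>X\<close> to a homotopy, and its ends are the
  extensions of the two maps; in particular these maps are proper.\<close>

lemma proper_homotopic_imp_proper:
  assumes X: "Z X" and Y: "Z Y" and h: "proper_homotopic (sub (compl X)) (sub (compl Y)) f g"
  shows "proper X Y f" "proper X Y g"
    "homotopic_with (\<lambda>_. True) (sub X) (sub Y) (restrict (ext X f) X) (restrict (ext X g) X)"
proof -
  obtain h where h: "proper_continuous_map (prod_topology (top_of_set {0..1::real}) (sub (compl X))) (sub (compl Y)) h"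
    "\<forall>x\<in>compl X. h (0, x) = f x" "\<forall>x\<in>compl X. h (1, x) = g x"
    using h unfolding proper_homotopic_def topspace_sub_compl by blast
  obtain E where E: "continuous_map (cylinder \<tau>) (cube \<tau>) E" "\<forall>t\<in>{0..1}. pair_map \<tau> X Y (\<lambda>x. E (t, x))"
    "\<forall>t\<in>{0..1}. \<forall>x\<in>compl X. E (t, x) = h (t, x)"
    using proper_homotopy_extension[OF X Y h(1)] by blast
  have E0: "pair_map \<tau> X Y (\<lambda>x. E (0, x))" and E1: "pair_map \<tau> X Y (\<lambda>x. E (1, x))" using E(2) by auto
  have f: "E (0, x) = f x" and g: "E (1, x) = g x" if "x \<in> compl X" for x
    using that E(3) h(2,3) by auto
  show "proper X Y f" by (rule proper_cong[OF pair_map_imp_proper[OF E0] f])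
  show "proper X Y g" by (rule proper_cong[OF pair_map_imp_proper[OF E1] g])
  have extf: "ext X f x = E (0, x)" and extg: "ext X g x = E (1, x)" if "x \<in> topspace (cube \<tau>)" for x
    using ext_eq[OF X _ f that] ext_eq[OF X _ g that] E0 E1 by (auto simp: pair_map_def)
  have "continuous_map (prod_topology (top_of_set {0..1}) (sub X)) (sub Y) E"
    unfolding cylinder_subtopology continuous_map_in_subtopology
    using E(1,2) by (auto simp: continuous_map_from_subtopology pair_map_def topspace_cylinder)
  then show "homotopic_with (\<lambda>_. True) (sub X) (sub Y) (restrict (ext X f) X) (restrict (ext X g) X)"
    unfolding homotopic_with_True_iff topspace_sub[OF X]
    using extf extg Z_set_subset[OF X] by (intro exI[of _ E]) auto
qed

text \<open>A homotopy over \<open>X\<close> together with the two extensions is a map \<open>\<phi>\<close> on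
  \<open>A = [0,1] \<times> X \<union> {0,1} \<times> I\<^sup>\<tau>\<close> with preimage \<open>[0,1] \<times> X\<close> of \<open>Y\<close>. Extended to the cylinder without meeting \<open>Y\<close>
  off \<open>A\<close>, it becomes a proper homotopy over the complement of \<open>X\<close>.\<close>

lemma homotopic_imp_proper_homotopic:
  assumes X: "Z X" and Y: "Z Y" and f: "proper X Y f" and g: "proper X Y g"
    and hom: "homotopic_with (\<lambda>_. True) (sub X) (sub Y) (restrict (ext X f) X) (restrict (ext X g) X)"
  shows "proper_homotopic (sub (compl X)) (sub (compl Y)) f g"
proof -
  note F = ext_proper[OF X Y f] and G = ext_proper[OF X Y g]
  have Xc: "closedin (cube \<tau>) X" by (rule Z_set_closedin[OF X])
  have Xs: "X \<subseteq> topspace (cube \<tau>)" by (rule Z_set_subset[OF X])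
  obtain k where k: "continuous_map (subtopology (cylinder \<tau>) ({0..1} \<times> X)) (sub Y) k"
    "\<And>x. x \<in> X \<Longrightarrow> k (0, x) = ext X f x" "\<And>x. x \<in> X \<Longrightarrow> k (1, x) = ext X g x"
    using hom unfolding homotopic_with_True_iff topspace_sub[OF X] cylinder_subtopology by auto
  have kY: "k p \<in> Y" if "p \<in> {0..1} \<times> X" for p
    using k(1) that Xs by (auto simp: continuous_map_in_subtopology topspace_cylinder)
  define A :: "(real \<times> ('k \<Rightarrow> real)) set" where
    "A = ({0..1} \<times> X) \<union> ({0,1} \<times> topspace (cube \<tau>))"
  define \<phi> where "\<phi> p = (if snd p \<in> X then k p else if fst p = 0 then ext X f (snd p) else ext X g (snd p))"
    for p :: "real \<times> ('k \<Rightarrow> real)"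
  define B :: "nat \<Rightarrow> (real \<times> ('k \<Rightarrow> real)) set" where
    "B i = (if i = 0 then {0..1} \<times> X else if i = 1 then {0} \<times> topspace (cube \<tau>)
      else {1} \<times> topspace (cube \<tau>))" for i
  define \<psi> where "\<psi> i = (if i = (0::nat) then k else if i = 1 then ext X f \<circ> snd else ext X g \<circ> snd)" for i
  have pt: "closedin (top_of_set {0..1::real}) {t}" if "t \<in> {0,1}" for t
    using that by (auto intro: closed_subset)
  have B_closed: "closedin (cylinder \<tau>) (B i)" for i
    using Xc pt by (auto simp: B_def cylinder_def closedin_prod_Times_iff)
  have A_eq: "A = B 0 \<union> B 1 \<union> B 2" by (auto simp: A_def B_def)
  have A: "closedin (cylinder \<tau>) A"
    unfolding A_eq by (intro closedin_Un B_closed)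
  \<comment> \<open>Pasting over the closed pieces \<open>B 0\<close> (the part over \<open>X\<close>), \<open>B 1\<close> (bottom) and \<open>B 2\<close> (top).\<close>
  have \<phi>: "continuous_map (subtopology (cylinder \<tau>) A) (cube \<tau>) \<phi>"
  proof (rule pasting_lemma_closed[where I = "{0,1,2}" and T = B and f = \<psi>])
    fix i :: nat assume i: "i \<in> {0,1,2}"
    then have BA: "B i \<subseteq> A" using A_eq by auto
    then show "closedin (subtopology (cylinder \<tau>) A) (B i)"
      using B_closed by (simp add: closedin_closed_subtopology A)
    have "continuous_map (subtopology (cylinder \<tau>) (B i)) (cube \<tau>) (ext X f \<circ> snd)"
      "continuous_map (subtopology (cylinder \<tau>) (B i)) (cube \<tau>) (ext X g \<circ> snd)"
      using F(1) G(1) unfolding pair_map_def cylinder_def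
      by (auto intro!: continuous_map_from_subtopology continuous_map_compose[OF continuous_map_snd])
    moreover have "continuous_map (subtopology (cylinder \<tau>) (B 0)) (cube \<tau>) k"
      using k(1) by (simp add: B_def continuous_map_in_subtopology)
    ultimately have "continuous_map (subtopology (cylinder \<tau>) (B i)) (cube \<tau>) (\<psi> i)"
      by (auto simp: \<psi>_def)
    then show "continuous_map (subtopology (subtopology (cylinder \<tau>) A) (B i)) (cube \<tau>) (\<psi> i)"
      using BA by (simp add: subtopology_subtopology Int_absorb1)
  next
    fix i j :: nat and p
    assume "i \<in> {0,1,2}" "j \<in> {0,1,2}" "p \<in> topspace (subtopology (cylinder \<tau>) A) \<inter> B i \<inter> B j"
    then show "\<psi> i p = \<psi> j p"
      using k(2,3) by (auto simp: \<psi>_def B_def split: if_splits)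
  next
    fix p assume p: "p \<in> topspace (subtopology (cylinder \<tau>) A)"
    obtain t x where tx: "p = (t, x)" by (cases p)
    have "t \<in> {0..1}" "x \<in> topspace (cube \<tau>)" "x \<in> X \<or> t = 0 \<or> t = 1"
      using p by (auto simp: tx A_def topspace_cylinder)
    then have "p \<in> B 0 \<and> \<phi> p = \<psi> 0 p \<or> p \<in> B 1 \<and> \<phi> p = \<psi> 1 p \<or> p \<in> B 2 \<and> \<phi> p = \<psi> 2 p"
      by (auto simp: tx \<phi>_def \<psi>_def B_def)
    then show "\<exists>j. j \<in> {0,1,2} \<and> p \<in> B j \<and> \<phi> p = \<psi> j p" by blast
  qed auto
  have "topspace (cylinder \<tau>) - A = {0<..<1} \<times> (topspace (cube \<tau>) - X)"
    by (auto simp: A_def topspace_cylinder)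
  then have U: "closed_union \<tau> (cylinder \<tau>) (topspace (cylinder \<tau>) - A)"
    using closed_union_open_interval_Times[OF tau closed_union_cube_compl[OF tau Xc]]
    by (simp add: cylinder_def)
  obtain H where H: "continuous_map (cylinder \<tau>) (cube \<tau>) H" "\<forall>p\<in>A. H p = \<phi> p"
    "\<forall>p\<in>topspace (cylinder \<tau>) - A. H p \<notin> Y"
    using Tietze_extension_avoiding_Z_set[OF tau Y normal_space_cylinder A U \<phi>] by blast
  have H_Y: "H (t, x) \<in> Y \<longleftrightarrow> x \<in> X" if t: "t \<in> {0..1}" and x: "x \<in> topspace (cube \<tau>)" for t x
  proof (cases "(t, x) \<in> A")
    case True
    show ?thesis
    proof (cases "x \<in> X")
      case True
      then have "(t, x) \<in> A" using t by (auto simp: A_def)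
      then show ?thesis using kY[of "(t, x)"] H(2) True t by (simp add: \<phi>_def)
    next
      case False
      then show ?thesis
        using F(1) G(1) H(2) \<open>(t, x) \<in> A\<close> x by (simp add: \<phi>_def pair_map_def)
    qed
  next
    case False
    then have "x \<notin> X" using t by (auto simp: A_def)
    then show ?thesis using H(3) False t x by (auto simp: topspace_cylinder)
  qed
  have "proper_continuous_map (prod_topology (top_of_set {0..1}) (sub (compl X))) (sub (compl Y)) H"
    unfolding cylinder_subtopology
  proof (rule proper_map_if_extension[OF compact_space_cylinder Hausdorff_space_cube H(1)])
    fix p assume p: "p \<in> topspace (cylinder \<tau>)"
    then have "H p \<in> topspace (cube \<tau>)" using H(1) by (auto simp: continuous_map_def)
    then show "H p \<in> compl Y \<longleftrightarrow> p \<in> {0..1} \<times> compl X"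
      using p H_Y[of "fst p" "snd p"] by (cases p) (auto simp: mem_compl topspace_cylinder)
  qed
  moreover have "H (0, x) = f x" "H (1, x) = g x" if "x \<in> compl X" for x
    using that H(2) F(2) G(2) by (auto simp: A_def mem_compl \<phi>_def)
  ultimately show ?thesis
    unfolding proper_homotopic_def topspace_sub_compl by blast
qed

section \<open>The isomorphism of the two homotopy categories\<close>

abbreviation (input) boundary :: "('k \<Rightarrow> real) set \<Rightarrow> (('k \<Rightarrow> real) \<Rightarrow> 'k \<Rightarrow> real) \<Rightarrow> ('k \<Rightarrow> real) \<Rightarrow> 'k \<Rightarrow> real" where
  "boundary X g \<equiv> restrict (ext X g) X"

abbreviation (input) hclass :: "('k \<Rightarrow> real) set \<Rightarrow> ('k \<Rightarrow> real) set \<Rightarrow> (('k \<Rightarrow> real) \<Rightarrow> 'k \<Rightarrow> real) \<Rightarrow> (('k \<Rightarrow> real) \<Rightarrow> 'k \<Rightarrow> real) set" where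
  "hclass X Y f \<equiv> homotopy_class (sub X) (sub Y) f"

abbreviation (input) pclass :: "('k \<Rightarrow> real) set \<Rightarrow> ('k \<Rightarrow> real) set \<Rightarrow> (('k \<Rightarrow> real) \<Rightarrow> 'k \<Rightarrow> real) \<Rightarrow> (('k \<Rightarrow> real) \<Rightarrow> 'k \<Rightarrow> real) set" where
  "pclass X Y g \<equiv> proper_homotopy_class (sub (compl X)) (sub (compl Y)) g"

lemma compl_compl: "Z X \<Longrightarrow> compl (compl X) = X"
  using Z_set_subset unfolding cube_compl_def by blast

lemma boundary_continuous:
  assumes "Z X" "Z Y" "proper X Y g"
  shows "continuous_map (sub X) (sub Y) (boundary X g)"
  by (rule continuous_map_eq[OF pair_map_imp_continuous[OF ext_proper(1)[OF assms]]])
    (simp add: topspace_sub assms(1))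

text \<open>Proper homotopy is the pullback of homotopy along the passage to boundary maps. So it is an equivalence
  relation on proper maps because homotopy is one.\<close>

lemma pclass_eq:
  assumes "Z X" "Z Y" "proper X Y g"
  shows "pclass X Y g = {g'. proper X Y g' \<and> hclass X Y (boundary X g') = hclass X Y (boundary X g)}"
  unfolding proper_homotopy_class_def
proof (intro Collect_cong iffI conjI)
  fix g'
  assume h: "proper_homotopic (sub (compl X)) (sub (compl Y)) g g'"
  note P = proper_homotopic_imp_proper[OF assms(1,2) h]
  show "proper X Y g'" by (rule P(2))
  show "hclass X Y (boundary X g') = hclass X Y (boundary X g)"
    by (rule sym[OF iffD2[OF homotopy_class_eq_iff[OF boundary_continuous[OF assms]] P(3)]])
next
  fix g'
  assume g': "proper X Y g' \<and> hclass X Y (boundary X g') = hclass X Y (boundary X g)"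
  then have "homotopic_with (\<lambda>_. True) (sub X) (sub Y) (boundary X g) (boundary X g')"
    by (intro iffD1[OF homotopy_class_eq_iff[OF boundary_continuous[OF assms]]]) simp
  then show "proper_homotopic (sub (compl X)) (sub (compl Y)) g g'"
    using homotopic_imp_proper_homotopic[OF assms] g' by blast
qed

lemma pclass_self: "Z X \<Longrightarrow> Z Y \<Longrightarrow> proper X Y g \<Longrightarrow> g \<in> pclass X Y g"
  by (simp add: pclass_eq)

lemma mu_mor_pclass:
  assumes "Z X" "Z Y" "proper X Y g"
  shows "mu_mor \<tau> (compl X) (compl Y) (pclass X Y g) = hclass X Y (boundary X g)"
proof -
  have "hclass X Y (boundary X g') = hclass X Y (boundary X g)" if "g' \<in> pclass X Y g" for g'
    using that by (simp add: pclass_eq[OF assms])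
  then show ?thesis
    using pclass_self[OF assms] unfolding mu_mor_def mu_obj_def compl_compl[OF assms(1)] compl_compl[OF assms(2)]
    by blast
qed

text \<open>The boundary map is computed from any map of pairs that extends \<open>g\<close>.\<close>

lemma boundary_eq:
  assumes "Z X" "pair_map \<tau> X Y F" "\<And>x. x \<in> compl X \<Longrightarrow> F x = g x"
  shows "boundary X g = restrict F X"
proof (rule restrict_ext)
  fix x assume "x \<in> X"
  then have "x \<in> topspace (cube \<tau>)" using Z_set_subset[OF assms(1)] by blast
  moreover have "continuous_map (cube \<tau>) (cube \<tau>) F"
    using assms(2) by (simp add: pair_map_def)
  ultimately show "ext X g x = F x"
    by (intro ext_eq[OF assms(1) _ assms(3)])
qed

lemma hclass_cong:
  assumes "Z X" "\<And>x. x \<in> X \<Longrightarrow> f x = g x" "continuous_map (sub X) (sub Y) f"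
  shows "hclass X Y f = hclass X Y g"
proof -
  have "homotopic_with (\<lambda>_. True) (sub X) (sub Y) f g"
    by (rule homotopic_with_equal[OF TrueI TrueI assms(3)]) (use assms(2) in auto)
  then show ?thesis using homotopy_class_eq_iff[OF assms(3)] by blast
qed

text \<open>The composite of the extensions extends the composite.\<close>

lemma proper_comp:
  assumes X: "Z X" and Y: "Z Y" and W: "Z W" and f: "proper X Y f" and g: "proper Y W g"
  shows "proper X W (g \<circ> f)"
    "hclass X W (boundary X (g \<circ> f)) = hclass X W (boundary Y g \<circ> boundary X f)"
proof -
  note F = ext_proper[OF X Y f] and G = ext_proper[OF Y W g]
  have GF: "pair_map \<tau> X W (ext Y g \<circ> ext X f)" by (rule pair_map_comp[OF F(1) G(1)])
  have eq: "(ext Y g \<circ> ext X f) x = (g \<circ> f) x" if x: "x \<in> compl X" for x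
  proof -
    have "f x \<in> compl Y"
      using f x unfolding proper_continuous_map_def continuous_map_def topspace_sub_compl by blast
    then show ?thesis using F(2)[OF x] G(2) by simp
  qed
  show "proper X W (g \<circ> f)"
    by (rule proper_cong[OF pair_map_imp_proper[OF GF] eq])
  have b: "boundary X (g \<circ> f) = restrict (ext Y g \<circ> ext X f) X"
    by (rule boundary_eq[OF X GF eq])
  show "hclass X W (boundary X (g \<circ> f)) = hclass X W (boundary Y g \<circ> boundary X f)"
    unfolding b
  proof (rule hclass_cong[OF X])
    fix x assume x: "x \<in> X"
    then have "ext X f x \<in> Y"
      using F(1) Z_set_subset[OF X] unfolding pair_map_def by blast
    then show "restrict (ext Y g \<circ> ext X f) X x = (boundary Y g \<circ> boundary X f) x"
      using x by simp
  next
    show "continuous_map (sub X) (sub W) (restrict (ext Y g \<circ> ext X f) X)"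
      by (rule continuous_map_eq[OF pair_map_imp_continuous[OF GF]])
        (simp add: topspace_sub[OF X])
  qed
qed

lemma Hom_Hp: "Hom (Hp_cat \<tau>) (compl X) (compl Y) = {pclass X Y g | g. proper X Y g}"
  by (simp add: Hp_cat_def Let_def)

lemma Hom_H: "Hom (H_cat \<tau>) X Y = {hclass X Y f | f. continuous_map (sub X) (sub Y) f}"
  by (simp add: H_cat_def Let_def)

text \<open>Injectivity is the description of proper homotopy classes by boundary maps; surjectivity extends a
  representative to a map of pairs.\<close>

lemma mu_mor_bij:
  assumes X: "Z X" and Y: "Z Y"
  shows "bij_betw (mu_mor \<tau> (compl X) (compl Y)) (Hom (Hp_cat \<tau>) (compl X) (compl Y)) (Hom (H_cat \<tau>) X Y)"
  unfolding bij_betw_def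
proof
  show "inj_on (mu_mor \<tau> (compl X) (compl Y)) (Hom (Hp_cat \<tau>) (compl X) (compl Y))"
  proof (rule inj_onI)
    fix c d
    assume "c \<in> Hom (Hp_cat \<tau>) (compl X) (compl Y)" "d \<in> Hom (Hp_cat \<tau>) (compl X) (compl Y)"
    then obtain g h where gh: "c = pclass X Y g" "proper X Y g" "d = pclass X Y h" "proper X Y h"
      unfolding Hom_Hp by blast
    assume "mu_mor \<tau> (compl X) (compl Y) c = mu_mor \<tau> (compl X) (compl Y) d"
    then have "hclass X Y (boundary X g) = hclass X Y (boundary X h)"
      using gh by (simp add: mu_mor_pclass[OF X Y])
    then show "c = d"
      using gh by (simp add: pclass_eq[OF X Y])
  qed
  show "mu_mor \<tau> (compl X) (compl Y) ` Hom (Hp_cat \<tau>) (compl X) (compl Y) = Hom (H_cat \<tau>) X Y"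
  proof (intro subset_antisym subsetI)
    fix d assume "d \<in> mu_mor \<tau> (compl X) (compl Y) ` Hom (Hp_cat \<tau>) (compl X) (compl Y)"
    then obtain g where "d = mu_mor \<tau> (compl X) (compl Y) (pclass X Y g)" "proper X Y g"
      unfolding Hom_Hp by blast
    then show "d \<in> Hom (H_cat \<tau>) X Y"
      unfolding Hom_H using mu_mor_pclass[OF X Y] boundary_continuous[OF X Y] by blast
  next
    fix d assume "d \<in> Hom (H_cat \<tau>) X Y"
    then obtain f where f: "d = hclass X Y f" "continuous_map (sub X) (sub Y) f"
      unfolding Hom_H by blast
    obtain F where F: "pair_map \<tau> X Y F" "\<forall>x\<in>X. F x = f x"
      using extend_to_pair_map[OF X Y f(2)] by blast
    have P: "proper X Y F" by (rule pair_map_imp_proper[OF F(1)])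
    have "boundary X F = restrict F X" by (rule boundary_eq[OF X F(1) refl])
    moreover have "hclass X Y f = hclass X Y (restrict F X)"
      by (rule hclass_cong[OF X _ f(2)]) (use F(2) in auto)
    ultimately have "mu_mor \<tau> (compl X) (compl Y) (pclass X Y F) = d"
      using mu_mor_pclass[OF X Y P] f(1) by simp
    then show "d \<in> mu_mor \<tau> (compl X) (compl Y) ` Hom (Hp_cat \<tau>) (compl X) (compl Y)"
      unfolding Hom_Hp using P by blast
  qed
qed

lemma Hp_Comp:
  assumes X: "Z X" and Y: "Z Y" and W: "Z W" and f: "proper X Y f" and g: "proper Y W g"
  shows "Comp (Hp_cat \<tau>) (compl X) (compl Y) (compl W) (pclass Y W g) (pclass X Y f) = pclass X W (g \<circ> f)"
proof -
  have "pclass X W (g' \<circ> f') = pclass X W (g \<circ> f)" if f': "f' \<in> pclass X Y f" and g': "g' \<in> pclass Y W g" for f' g'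
  proof -
    have pf: "proper X Y f'" "hclass X Y (boundary X f') = hclass X Y (boundary X f)"
      using f' by (auto simp: pclass_eq[OF X Y f])
    have pg: "proper Y W g'" "hclass Y W (boundary Y g') = hclass Y W (boundary Y g)"
      using g' by (auto simp: pclass_eq[OF Y W g])
    have "hclass X W (boundary Y g' \<circ> boundary X f') = hclass X W (boundary Y g \<circ> boundary X f)"
      using homotopy_class_comp[OF boundary_continuous[OF X Y f] boundary_continuous[OF Y W g]]
        homotopy_class_comp[OF boundary_continuous[OF X Y pf(1)] boundary_continuous[OF Y W pg(1)]]
      by (simp add: pf(2) pg(2))
    then show ?thesis
      using proper_comp[OF X Y W f g] proper_comp[OF X Y W pf(1) pg(1)] by (simp add: pclass_eq[OF X W])
  qed
  moreover have "Comp (Hp_cat \<tau>) (compl X) (compl Y) (compl W) (pclass Y W g) (pclass X Y f)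
      = (\<Union>f'\<in>pclass X Y f. \<Union>g'\<in>pclass Y W g. pclass X W (g' \<circ> f'))"
    by (simp add: Hp_cat_def Let_def)
  ultimately show ?thesis
    using pclass_self[OF X Y f] pclass_self[OF Y W g] by blast
qed

lemma mu_is_category_isomorphism:
  "is_category_isomorphism (Hp_cat \<tau>) (H_cat \<tau>) (mu_obj \<tau>) (mu_mor \<tau>)"
proof (rule is_category_isomorphismI[OF is_category_H_cat])
  have Obj_Hp: "Obj (Hp_cat \<tau>) = compl ` {X. Z X}"
    by (auto simp: Hp_cat_def Let_def)
  have Obj_H: "Obj (H_cat \<tau>) = {X. Z X}"
    by (simp add: H_cat_def Let_def)
  have mu: "mu_obj \<tau> (compl X) = X" if "Z X" for X
    using compl_compl[OF that] by (simp add: mu_obj_def)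
  show "bij_betw (mu_obj \<tau>) (Obj (Hp_cat \<tau>)) (Obj (H_cat \<tau>))"
    unfolding Obj_Hp Obj_H bij_betw_def using mu by (auto simp: inj_on_def image_image)
  show "bij_betw (mu_mor \<tau> M N) (Hom (Hp_cat \<tau>) M N) (Hom (H_cat \<tau>) (mu_obj \<tau> M) (mu_obj \<tau> N))"
    if "M \<in> Obj (Hp_cat \<tau>)" "N \<in> Obj (Hp_cat \<tau>)" for M N
    using that mu_mor_bij mu unfolding Obj_Hp by auto
  show "Ident (Hp_cat \<tau>) M \<in> Hom (Hp_cat \<tau>) M M \<and>
      mu_mor \<tau> M M (Ident (Hp_cat \<tau>) M) = Ident (H_cat \<tau>) (mu_obj \<tau> M)"
    if M: "M \<in> Obj (Hp_cat \<tau>)" for M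
  proof -
    obtain X where X: "M = compl X" "Z X" using M unfolding Obj_Hp by blast
    have P: "proper X X id" by (rule pair_map_imp_proper[OF pair_map_id])
    have id: "Ident (Hp_cat \<tau>) (compl X) = pclass X X id" by (simp add: Hp_cat_def Let_def)
    have "boundary X id = restrict id X" by (rule boundary_eq[OF X(2) pair_map_id refl])
    moreover have "hclass X X id = hclass X X (restrict id X)"
      by (rule hclass_cong[OF X(2)]) (auto simp: id_def)
    ultimately have "mu_mor \<tau> M M (Ident (Hp_cat \<tau>) M) = hclass X X id"
      unfolding X(1) id using mu_mor_pclass[OF X(2) X(2) P] by simp
    then show ?thesis
      unfolding X(1) id Hom_Hp mu[OF X(2)] using P by (auto simp: H_cat_def Let_def)
  qed
  show "Comp (Hp_cat \<tau>) M N P d c \<in> Hom (Hp_cat \<tau>) M P \<and>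
      mu_mor \<tau> M P (Comp (Hp_cat \<tau>) M N P d c) =
      Comp (H_cat \<tau>) (mu_obj \<tau> M) (mu_obj \<tau> N) (mu_obj \<tau> P) (mu_mor \<tau> N P d) (mu_mor \<tau> M N c)"
    if M: "M \<in> Obj (Hp_cat \<tau>)" and N: "N \<in> Obj (Hp_cat \<tau>)" and P: "P \<in> Obj (Hp_cat \<tau>)"
      and c: "c \<in> Hom (Hp_cat \<tau>) M N" and d: "d \<in> Hom (Hp_cat \<tau>) N P" for M N P c d
  proof -
    obtain X Y W where XYW: "M = compl X" "N = compl Y" "P = compl W" and X: "Z X" and Y: "Z Y" and W: "Z W"
      using M N P unfolding Obj_Hp by blast
    obtain f where f: "c = pclass X Y f" "proper X Y f" using c unfolding XYW Hom_Hp by blast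
    obtain g where g: "d = pclass Y W g" "proper Y W g" using d unfolding XYW Hom_Hp by blast
    note gf = proper_comp[OF X Y W f(2) g(2)]
    have "Comp (H_cat \<tau>) X Y W (hclass Y W (boundary Y g)) (hclass X Y (boundary X f))
        = hclass X W (boundary Y g \<circ> boundary X f)"
      using homotopy_class_comp[OF boundary_continuous[OF X Y f(2)] boundary_continuous[OF Y W g(2)]]
      by (simp add: H_cat_def Let_def)
    then show ?thesis
      unfolding XYW f(1) g(1) Hp_Comp[OF X Y W f(2) g(2)] mu[OF X] mu[OF Y] mu[OF W]
        mu_mor_pclass[OF X Y f(2)] mu_mor_pclass[OF Y W g(2)] mu_mor_pclass[OF X W gf(1)] gf(2) Hom_Hp
      using gf(1) by auto
  qed
qed

end

theorem proposition5p4: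
  fixes \<tau> :: "'k rel"
  assumes "Card_order \<tau>" and "natLeq <o \<tau>"
  shows "(\<forall>X. Z_set \<tau> (cube \<tau>) X \<longrightarrow> mu_obj \<tau> (cube_compl \<tau> X) = X) \<and>
         (\<forall>X Y g. Z_set \<tau> (cube \<tau>) X \<longrightarrow> Z_set \<tau> (cube \<tau>) Y \<longrightarrow>
            proper_continuous_map (subtopology (cube \<tau>) (cube_compl \<tau> X))
                                  (subtopology (cube \<tau>) (cube_compl \<tau> Y)) g \<longrightarrow>
            mu_mor \<tau> (cube_compl \<tau> X) (cube_compl \<tau> Y)
              (proper_homotopy_class (subtopology (cube \<tau>) (cube_compl \<tau> X))
                                     (subtopology (cube \<tau>) (cube_compl \<tau> Y)) g)
            = homotopy_class (subtopology (cube \<tau>) X) (subtopology (cube \<tau>) Y)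
                (restrict (cube_extension \<tau> (cube_compl \<tau> X) g) X)) \<and>
         is_category_isomorphism (Hp_cat \<tau>) (H_cat \<tau>) (mu_obj \<tau>) (mu_mor \<tau>)"
  using compl_compl[OF assms] mu_mor_pclass[OF assms] mu_is_category_isomorphism[OF assms]
  by (simp add: mu_obj_def)

end
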